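(* Let $u$, $\mathbf i=(i_1,\dots,i_n)$ and $\mathbf Y\in(\mathbb C^\times)^n$ be as in the context, let $1\le k\le n$ and $d:=i_k$, and let $a=t^h\in H$ with $h\in\mathfrak h$, $t\in\mathbb C^\times$. Then $$\Delta^G(k;\mathbf i)(a,\mathbf Y)=t^{(u_{\le k}\Lambda_d)(h)}\,\Delta^L(k;\mathbf i)(\mathbf Y).$$
   Context: Let $G$ be the simply connected simple algebraic group over $\mathbb C$ of type $\mathrm B_r$, $B,B_-$ opposite Borel subgroups, $N\subset B$, $N_-\subset B_-$ their unipotent radicals, $H=B\cap B_-$, $\mathfrak h=\mathrm{Lie}(H)$, $W=\mathrm{Norm}_G(H)/H$ the Weyl group with simple reflections $s_1,\dots,s_r$. Chevalley generators $e_i,f_i$ and simple coroots $h_i$ of $\mathrm{Lie}(G)$ are taken for the Cartan matrix $a_{ij}=\alpha_j(h_i)$ with $a_{ii}=2$, $a_{ij}=-1$ if $|i-j|=1$ and $(i,j)\ne(r,r-1)$, $a_{r,r-1}=-2$, and $a_{ij}=0$ otherwise. $\Lambda_i$ is the $i$-th fundamental weight. Put $x_i(t)=\exp(te_i)$, $y_i(t)=\exp(tf_i)$, $\alpha_i^\vee(t)=t^{h_i}$, $x_{-i}(t)=y_i(t)\alpha_i^\vee(t^{-1})$, $\overline{s_i}=x_i(-1)y_i(1)x_i(-1)$; for a reduced expression $w=s_{j_1}\cdots s_{j_p}$ put $\overline w=\overline{s_{j_1}}\cdots\overline{s_{j_p}}$. For $x\in G_0=N_-HN$ write $x=[x]_-[x]_0[x]_+$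 accordingly; $\Delta_{w\Lambda_i,\Lambda_i}$ is the regular function on $G$ whose restriction to $\overline wG_0$ is $x\mapsto([\overline w^{-1}x]_0)^{\Lambda_i}$. For $1\le m\le r$ and $1\le i_n\le r$ let $n=(m-1)r+i_n$, $u=(s_1\cdots s_r)^{m-1}s_1\cdots s_{i_n}\in W$, with reduced word $\mathbf i=(1,\dots,r,\dots,1,\dots,r,1,\dots,i_n)$ ($m-1$ full cycles followed by $1,\dots,i_n$), whose $k$-th letter is denoted $i_k$. Put $u_{\le k}=s_{i_1}\cdots s_{i_k}$, $\Delta(k;\mathbf i)=\Delta_{u_{\le k}\Lambda_{i_k},\Lambda_{i_k}}$, $x^L_{\mathbf i}(t_1,\dots,t_n)=x_{-i_1}(t_1)\cdots x_{-i_n}(t_n)$ and $\overline x^G_{\mathbf i}(a;t_1,\dots,t_n)=a\,x^L_{\mathbf i}(t_1,\dots,t_n)$ for $a\in H$. Then $\Delta^L(k;\mathbf i)=\Delta(k;\mathbf i)\circ x^L_{\mathbf i}$ and $\Delta^G(k;\mathbf i)=\Delta(k;\mathbf i)\circ\overline x^G_{\mathbf i}$, with variables $\mathbf Y=(Y_{1,1},\dots,Y_{1,r},\dots,Y_{m-1,1},\dots,Y_{m-1,r},Y_{m,1},\dots,Y_{m,i_n})\in(\mathbb C^\times)^n$ inserted in this order. For $t\in\mathbb C^\times$ with a fixed choice of $\log t$, $t^h=\exp((\log t)h)\in H$ for $h\in\mathfrak h$ and $t^c=e^{c\log t}$ for $c\in\mathbb C$ (no choice is needed when $h$ is in the coroot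 lattice). *)

theory Defs
  imports "HOL-Analysis.Analysis" "HOL-Algebra.Solvable_Groups" "HOL-Algebra.Group_Action"
begin

section \<open>Complex matrices: scalar multiples, exponential, Lie bracket\<close>

definition cscale :: "complex \<Rightarrow> complex^'n^'m \<Rightarrow> complex^'n^'m"  (infixr \<open>*\<^sub>C\<close> 75)
  where "c *\<^sub>C A = (\<chi> i j. c * A $ i $ j)"

interpretation cmat: vector_space "cscale :: complex \<Rightarrow> complex^'n^'m \<Rightarrow> complex^'n^'m"
  by unfold_locales (simp_all add: cscale_def vec_eq_iff algebra_simps)

definition mpow :: "complex^'n^'n \<Rightarrow> nat \<Rightarrow> complex^'n^'n"
  where "mpow A k = (((**) A) ^^ k) (mat 1)"

definition mexp :: "complex^'n^'n \<Rightarrow> complex^'n^'n"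
  where "mexp A = suminf (\<lambda>k. (1 / fact k) *\<^sub>R mpow A k)"

definition bracket :: "complex^'n^'n \<Rightarrow> complex^'n^'n \<Rightarrow> complex^'n^'n"
  where "bracket X Y = X ** Y - Y ** X"

definition lie_subalgebra :: "(complex^'n^'n) set \<Rightarrow> bool"
  where "lie_subalgebra L \<longleftrightarrow> cmat.subspace L \<and> (\<forall>X\<in>L. \<forall>Y\<in>L. bracket X Y \<in> L)"

definition lie_generated :: "(complex^'n^'n) set \<Rightarrow> (complex^'n^'n) set"
  where "lie_generated S = \<Inter> {L. lie_subalgebra L \<and> S \<subseteq> L}"


section \<open>Linear algebraic groups over the complex numbers\<close>

text \<open>
  A linear algebraic group is a Zariski closed subgroup of some \<open>GL\<^sub>N\<close>, where \<open>N\<close> is the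
  cardinality of the index type. For complex algebraic groups connectedness
  in the Zariski and in the classical topology coincide, and an algebraic group is simply connected
  iff its group of complex points is simply connected as a topological space; the library notions
  \<open>connected\<close> and \<open>simply_connected\<close> (for the classical topology) are used below.
\<close>

inductive_set polynomial_functions :: "(complex^'n^'n \<Rightarrow> complex) set" where
  const: "(\<lambda>A. c) \<in> polynomial_functions"
| entry: "(\<lambda>A. A $ i $ j) \<in> polynomial_functions"
| add: "p \<in> polynomial_functions \<Longrightarrow> q \<in> polynomial_functions
          \<Longrightarrow> (\<lambda>A. p A + q A) \<in> polynomial_functions"
| mult: "p \<in> polynomial_functions \<Longrightarrow> q \<in> polynomial_functions
          \<Longrightarrow> (\<lambda>A. p A * q A) \<in> polynomial_functions"

definition matgrp :: "(complex^'n^'n) set \<Rightarrow> (complex^'n^'n) monoid"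
  where "matgrp S = \<lparr>carrier = S, monoid.mult = (**), one = mat 1\<rparr>"

definition GL :: "(complex^'n^'n) set"
  where "GL = {A. invertible A}"

definition algebraic_group :: "(complex^'n^'n) set \<Rightarrow> bool"
  where "algebraic_group G \<longleftrightarrow> subgroup G (matgrp GL) \<and>
           (\<exists>P \<subseteq> polynomial_functions. G = {A \<in> GL. \<forall>p\<in>P. p A = 0})"

definition regular_on :: "(complex^'n^'n) set \<Rightarrow> (complex^'n^'n \<Rightarrow> complex) \<Rightarrow> bool"
  where "regular_on G f \<longleftrightarrow>
           (\<exists>p \<in> polynomial_functions. \<exists>k. \<forall>A\<in>G. f A = p A / det A ^ k)"

definition Lie :: "(complex^'n^'n) set \<Rightarrow> (complex^'n^'n) set"
  where "Lie G = {X. \<forall>z::complex. mexp (z *\<^sub>C X) \<in> G}"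

definition simple_algebraic_group :: "(complex^'n^'n) set \<Rightarrow> bool"
  where "simple_algebraic_group G \<longleftrightarrow> algebraic_group G \<and> connected G \<and>
           (\<exists>A\<in>G. \<exists>B\<in>G. A ** B \<noteq> B ** A) \<and>
           (\<forall>K. algebraic_group K \<and> connected K \<and> K \<lhd> matgrp G \<longrightarrow> K = {mat 1} \<or> K = G)"

definition connected_solvable_subgroup :: "(complex^'n^'n) set \<Rightarrow> (complex^'n^'n) set \<Rightarrow> bool"
  where "connected_solvable_subgroup B G \<longleftrightarrow>
           algebraic_group B \<and> B \<subseteq> G \<and> connected B \<and> solvable (matgrp B)"

definition borel_subgroup :: "(complex^'n^'n) set \<Rightarrow> (complex^'n^'n) set \<Rightarrow> bool"
  where "borel_subgroup B G \<longleftrightarrow> connected_solvable_subgroup B G \<and>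
           (\<forall>B'. connected_solvable_subgroup B' G \<and> B \<subseteq> B' \<longrightarrow> B' = B)"

definition torus :: "(complex^'n^'n) set \<Rightarrow> bool"
  where "torus T \<longleftrightarrow> algebraic_group T \<and> connected T \<and>
           (\<exists>P :: complex^'n^'n. invertible P \<and>
              (\<forall>A\<in>T. \<forall>i j. i \<noteq> j \<longrightarrow> (P ** A ** matrix_inv P) $ i $ j = 0))"

definition maximal_torus :: "(complex^'n^'n) set \<Rightarrow> (complex^'n^'n) set \<Rightarrow> bool"
  where "maximal_torus T G \<longleftrightarrow> torus T \<and> T \<subseteq> G \<and>
           (\<forall>T'. torus T' \<and> T' \<subseteq> G \<and> T \<subseteq> T' \<longrightarrow> T' = T)"

definition opposite_borels ::
    "(complex^'n^'n) set \<Rightarrow> (complex^'n^'n) set \<Rightarrow> (complex^'n^'n) set \<Rightarrow> bool"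
  where "opposite_borels B B' G \<longleftrightarrow>
           borel_subgroup B G \<and> borel_subgroup B' G \<and> maximal_torus (B \<inter> B') G"

definition connected_normal_unipotent :: "(complex^'n^'n) set \<Rightarrow> (complex^'n^'n) set \<Rightarrow> bool"
  where "connected_normal_unipotent U B \<longleftrightarrow>
           algebraic_group U \<and> connected U \<and> U \<lhd> matgrp B \<and>
           (\<forall>A\<in>U. \<exists>k. mpow (A - mat 1) k = 0)"

definition is_unipotent_radical :: "(complex^'n^'n) set \<Rightarrow> (complex^'n^'n) set \<Rightarrow> bool"
  where "is_unipotent_radical U B \<longleftrightarrow> connected_normal_unipotent U B \<and>
           (\<forall>U'. connected_normal_unipotent U' B \<longrightarrow> U' \<subseteq> U)"


section \<open>The simply connected simple group of type B with its Chevalley generators\<close>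

record ('n::finite) frame =
  grp :: "(complex^'n^'n) set"
  borel :: "(complex^'n^'n) set"
  borel_op :: "(complex^'n^'n) set"
  unip :: "(complex^'n^'n) set"
  unip_op :: "(complex^'n^'n) set"
  ee :: "nat \<Rightarrow> complex^'n^'n"
  ff :: "nat \<Rightarrow> complex^'n^'n"
  hh :: "nat \<Rightarrow> complex^'n^'n"

definition cartan :: "'n::finite frame \<Rightarrow> (complex^'n^'n) set"
  where "cartan D = borel D \<inter> borel_op D"

definition cartan_matrix_B :: "nat \<Rightarrow> nat \<Rightarrow> nat \<Rightarrow> int"
  where "cartan_matrix_B r i j =
           (if i = j then 2
            else if i = r \<and> j + 1 = r then -2
            else if i = j + 1 \<or> j = i + 1 then -1
            else 0)"

text \<open>
  The Cartan matrix is indexed so that \<open>a i j = \<alpha>\<^sub>j(h\<^sub>i)\<close>. The last clause but one lists the Serre relations; together with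
  the last one it says that the Lie algebra of \<open>G\<close> is the simple Lie algebra of type \<open>B\<^sub>r\<close>.
\<close>

definition chevalley_generators :: "nat \<Rightarrow> (nat \<Rightarrow> nat \<Rightarrow> int) \<Rightarrow> 'n::finite frame \<Rightarrow> bool"
  where "chevalley_generators r a D \<longleftrightarrow>
     (\<forall>i\<in>{1..r}. ee D i \<in> Lie (unip D) \<and> ff D i \<in> Lie (unip_op D)) \<and>
     inj_on (hh D) {1..r} \<and> cmat.independent (hh D ` {1..r}) \<and>
     cmat.span (hh D ` {1..r}) = Lie (cartan D) \<and>
     (\<forall>i\<in>{1..r}. \<forall>j\<in>{1..r}.
        bracket (hh D i) (hh D j) = 0 \<and>
        bracket (hh D i) (ee D j) = of_int (a i j) *\<^sub>C ee D j \<and>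
        bracket (hh D i) (ff D j) = - of_int (a i j) *\<^sub>C ff D j \<and>
        bracket (ee D i) (ff D j) = (if i = j then hh D i else 0)) \<and>
     (\<forall>i\<in>{1..r}. \<forall>j\<in>{1..r}. i \<noteq> j \<longrightarrow>
        (bracket (ee D i) ^^ nat (1 - a i j)) (ee D j) = 0 \<and>
        (bracket (ff D i) ^^ nat (1 - a i j)) (ff D j) = 0) \<and>
     lie_generated (ee D ` {1..r} \<union> ff D ` {1..r} \<union> hh D ` {1..r}) = Lie (grp D)"

definition simply_connected_type_B :: "nat \<Rightarrow> 'n::finite frame \<Rightarrow> bool"
  where "simply_connected_type_B r D \<longleftrightarrow>
     simple_algebraic_group (grp D) \<and> simply_connected (grp D) \<and>
     opposite_borels (borel D) (borel_op D) (grp D) \<and>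
     is_unipotent_radical (unip D) (borel D) \<and>
     is_unipotent_radical (unip_op D) (borel_op D) \<and>
     chevalley_generators r (cartan_matrix_B r) D"

text \<open>The \<open>i\<close>-th fundamental weight is the \<open>i\<close>-th coordinate functional with respect to the basis
  of simple coroots, i.e. \<open>\<Lambda>\<^sub>i(h\<^sub>j) = \<delta>\<^sub>i\<^sub>j\<close>.\<close>

definition fundamental_weight :: "nat \<Rightarrow> 'n::finite frame \<Rightarrow> nat \<Rightarrow> complex^'n^'n \<Rightarrow> complex"
  where "fundamental_weight r D i X = cmat.representation (hh D ` {1..r}) X (hh D i)"


section \<open>One-parameter subgroups, Weyl group and representatives\<close>

definition xx :: "'n::finite frame \<Rightarrow> nat \<Rightarrow> complex \<Rightarrow> complex^'n^'n"
  where "xx D i t = mexp (t *\<^sub>C ee D i)"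

definition yy :: "'n::finite frame \<Rightarrow> nat \<Rightarrow> complex \<Rightarrow> complex^'n^'n"
  where "yy D i t = mexp (t *\<^sub>C ff D i)"

text \<open>The power \<open>t\<^sup>X\<close>, for a chosen logarithm \<open>l\<close> of \<open>t\<close>.\<close>

definition torus_power :: "complex \<Rightarrow> complex^'n^'n \<Rightarrow> complex^'n^'n"
  where "torus_power l X = mexp (l *\<^sub>C X)"

text \<open>Using the principal logarithm here is harmless because \<open>exp(2\<pi>\<i> h\<^sub>i) = 1\<close>.\<close>

definition coroot :: "'n::finite frame \<Rightarrow> nat \<Rightarrow> complex \<Rightarrow> complex^'n^'n"
  where "coroot D i t = torus_power (Ln t) (hh D i)"

definition xneg :: "'n::finite frame \<Rightarrow> nat \<Rightarrow> complex \<Rightarrow> complex^'n^'n"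
  where "xneg D i t = yy D i t ** coroot D i (inverse t)"

definition sbar :: "'n::finite frame \<Rightarrow> nat \<Rightarrow> complex^'n^'n"
  where "sbar D i = xx D i (-1) ** yy D i 1 ** xx D i (-1)"

definition weyl_group :: "'n::finite frame \<Rightarrow> (complex^'n^'n) set monoid"
  where "weyl_group D = matgrp (normalizer (matgrp (grp D)) (cartan D)) Mod cartan D"

definition simple_reflection :: "'n::finite frame \<Rightarrow> nat \<Rightarrow> (complex^'n^'n) set"
  where "simple_reflection D i = cartan D #>\<^bsub>matgrp (grp D)\<^esub> sbar D i"

definition weyl_word :: "'n::finite frame \<Rightarrow> nat list \<Rightarrow> (complex^'n^'n) set"
  where "weyl_word D js =
           foldr (\<lambda>j w. simple_reflection D j \<otimes>\<^bsub>weyl_group D\<^esub> w) js \<one>\<^bsub>weyl_group D\<^esub>"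

definition reduced_word :: "nat \<Rightarrow> 'n::finite frame \<Rightarrow> (complex^'n^'n) set \<Rightarrow> nat list \<Rightarrow> bool"
  where "reduced_word r D w js \<longleftrightarrow> set js \<subseteq> {1..r} \<and> weyl_word D js = w \<and>
           (\<forall>js'. set js' \<subseteq> {1..r} \<and> weyl_word D js' = w \<longrightarrow> length js \<le> length js')"

text \<open>By the braid relations the representative of \<open>w\<close> is the same for all reduced words.\<close>

definition wbar :: "nat \<Rightarrow> 'n::finite frame \<Rightarrow> (complex^'n^'n) set \<Rightarrow> complex^'n^'n"
  where "wbar r D w = foldr (\<lambda>j A. sbar D j ** A) (SOME js. reduced_word r D w js) (mat 1)"

text \<open>The action of \<open>W = Norm\<^sub>G(H)/H\<close> on the dual of \<open>Lie H\<close>: \<open>(w \<mu>)(X) = \<mu>(Ad(n)\<^sup>-\<^sup>1 X)\<close> for any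
  representative \<open>n\<close> of \<open>w\<close>; representatives differ by elements of \<open>H\<close>, which fix \<open>Lie H\<close>.\<close>

definition weyl_act ::
    "(complex^'n^'n) set \<Rightarrow> (complex^'n^'n \<Rightarrow> complex) \<Rightarrow> complex^'n^'n \<Rightarrow> complex"
  where "weyl_act w \<mu> X = (let n = (SOME n. n \<in> w) in \<mu> (matrix_inv n ** X ** n))"


section \<open>Generalized minors\<close>

definition big_cell :: "'n::finite frame \<Rightarrow> (complex^'n^'n) set"
  where "big_cell D = {n' ** a ** n | n' a n. n' \<in> unip_op D \<and> a \<in> cartan D \<and> n \<in> unip D}"

definition torus_part :: "'n::finite frame \<Rightarrow> complex^'n^'n \<Rightarrow> complex^'n^'n"
  where "torus_part D x =
           (THE a. a \<in> cartan D \<and> (\<exists>n'\<in>unip_op D. \<exists>n\<in>unip D. x = n' ** a ** n))"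

text \<open>\<open>\<psi>\<close> is the character \<open>a \<mapsto> a\<^sup>\<mu>\<close> of the torus \<open>H\<close>, i.e. the one with differential \<open>\<mu>\<close>.\<close>

definition weight_character ::
    "(complex^'n^'n) set \<Rightarrow> (complex^'n^'n \<Rightarrow> complex) \<Rightarrow> (complex^'n^'n \<Rightarrow> complex) \<Rightarrow> bool"
  where "weight_character H \<mu> \<psi> \<longleftrightarrow>
     regular_on H \<psi> \<and> (\<forall>a\<in>H. \<psi> a \<noteq> 0) \<and> (\<forall>a\<in>H. \<forall>b\<in>H. \<psi> (a ** b) = \<psi> a * \<psi> b) \<and>
     (\<forall>X\<in>Lie H. \<psi> (mexp X) = exp (\<mu> X))"

text \<open>\<open>f\<close> is, as a function on \<open>G\<close>, the generalized minor attached to the extremal weight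
  \<open>w \<Lambda>\<^sub>i\<close> and to \<open>\<Lambda>\<^sub>i\<close>. Such an \<open>f\<close> is unique on \<open>G\<close>, as the translate of the big cell is dense.\<close>

definition is_generalized_minor ::
    "nat \<Rightarrow> 'n::finite frame \<Rightarrow> (complex^'n^'n) set \<Rightarrow> nat \<Rightarrow> (complex^'n^'n \<Rightarrow> complex) \<Rightarrow> bool"
  where "is_generalized_minor r D w i f \<longleftrightarrow>
     regular_on (grp D) f \<and>
     (\<exists>\<psi>. weight_character (cartan D) (fundamental_weight r D i) \<psi> \<and>
        (\<forall>x \<in> (\<lambda>y. wbar r D w ** y) ` big_cell D.
           f x = \<psi> (torus_part D (matrix_inv (wbar r D w) ** x))))"


section \<open>The word \<open>i\<close>, the variables \<open>Y\<close> and the functions of the torus variables\<close>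

text \<open>\<open>m - 1\<close> full cycles \<open>1, \<dots>, r\<close> followed by \<open>1, \<dots>, p\<close>.\<close>

definition cyclic_word :: "nat \<Rightarrow> nat \<Rightarrow> nat \<Rightarrow> nat list"
  where "cyclic_word r m p = concat (replicate (m - 1) [1..<r + 1]) @ [1..<p + 1]"

definition variable_list :: "nat \<Rightarrow> nat \<Rightarrow> nat \<Rightarrow> (nat \<Rightarrow> nat \<Rightarrow> complex) \<Rightarrow> complex list"
  where "variable_list r m p Y =
           concat (map (\<lambda>s. map (Y s) [1..<r + 1]) [1..<m]) @ map (Y m) [1..<p + 1]"

definition u_le :: "'n::finite frame \<Rightarrow> nat list \<Rightarrow> nat \<Rightarrow> (complex^'n^'n) set"
  where "u_le D js k = weyl_word D (take k js)"

text \<open>Letters of the word are numbered from 1, list positions from 0.\<close>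

definition letter :: "nat list \<Rightarrow> nat \<Rightarrow> nat"
  where "letter js k = js ! (k - 1)"

definition is_Delta ::
    "nat \<Rightarrow> 'n::finite frame \<Rightarrow> nat list \<Rightarrow> nat \<Rightarrow> (complex^'n^'n \<Rightarrow> complex) \<Rightarrow> bool"
  where "is_Delta r D js k \<Delta> \<longleftrightarrow> is_generalized_minor r D (u_le D js k) (letter js k) \<Delta>"

definition xL :: "'n::finite frame \<Rightarrow> nat list \<Rightarrow> complex list \<Rightarrow> complex^'n^'n"
  where "xL D js ts = foldr (\<lambda>(i, t) A. xneg D i t ** A) (zip js ts) (mat 1)"

definition xG :: "'n::finite frame \<Rightarrow> nat list \<Rightarrow> (complex^'n^'n) \<times> complex list \<Rightarrow> complex^'n^'n"
  where "xG D js = (\<lambda>(a, ts). a ** xL D js ts)"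

definition Delta_L ::
    "'n::finite frame \<Rightarrow> nat list \<Rightarrow> (complex^'n^'n \<Rightarrow> complex) \<Rightarrow> complex list \<Rightarrow> complex"
  where "Delta_L D js \<Delta> = \<Delta> \<circ> xL D js"

definition Delta_G ::
    "'n::finite frame \<Rightarrow> nat list \<Rightarrow> (complex^'n^'n \<Rightarrow> complex)
       \<Rightarrow> (complex^'n^'n) \<times> complex list \<Rightarrow> complex"
  where "Delta_G D js \<Delta> = \<Delta> \<circ> xG D js"

end

theory Submission
  imports Defs "HOL-Complex_Analysis.Cauchy_Integral_Formula"
begin

text \<open>
  Write \<open>w\<close> for \<open>u\<^sub>\<le>\<^sub>k\<close>, \<open>W\<close> for its representative and \<open>a = exp (l h)\<close>. On the translated big cell the
  formula \<open>\<Delta> (a x) = exp (l (w \<Lambda>)(h)) \<Delta> x\<close> is immediate: if \<open>x = W n' b n\<close>, then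
  \<open>a x = W a' n' b n\<close> with \<open>a' = W\<^sup>-\<^sup>1 a W\<close> again in \<open>H\<close>, and since \<open>a'\<close> normalizes \<open>N\<^sub>-\<close> the torus part of
  \<open>a' n' b n\<close> is \<open>a' b\<close>. Torus parts are well defined because \<open>N\<^sub>- \<inter> H\<close> and \<open>N \<inter> H\<close> consist of
  matrices that are both unipotent and diagonalizable (\<open>torus_part_eq\<close>).

  The points \<open>x\<^sup>L(Y)\<close> need not lie in that cell, so the identity has to be continued to them. After
  clearing the determinant it says that a polynomial function \<open>q\<close> of the matrix vanishes. Since
  \<open>W\<close> and \<open>x\<^sup>L(Y)\<close> are products of exponentials of multiples of the \<open>e\<^sub>i\<close>, \<open>f\<^sub>i\<close> and of elements of
  \<open>Lie H\<close>, it suffices that a polynomial function vanishing on all ordered products (first \<open>f\<close>'s,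
  then torus, then \<open>e\<close>'s) vanishes on all products of exponentials, in whatever order
  (\<open>polynomial_vanishing_from_triangular_products\<close>). To see this, let \<open>X\<close>
  act on polynomial functions as the derivation \<open>D\<^sub>X\<close> along \<open>A \<mapsto> A exp (t X)\<close>. Vanishing on ordered
  products kills at \<open>1\<close> all ordered words in these derivations. As \<open>[D\<^sub>X, D\<^sub>Y] = D\<close> of \<open>[X, Y]\<close>, and a
  bracket of two letters of different kinds is again a letter, every word can be sorted up to shorter
  words, so by induction on the length all words are killed. These are the Taylor
  coefficients of \<open>q\<close> along any product of exponentials, so \<open>q\<close> vanishes there. This is the spanning
  half of the Poincare-Birkhoff-Witt theorem.

  The remaining input is that \<open>Ad\<close> of \<open>W\<^sup>-\<^sup>1\<close> preserves \<open>Lie H\<close> and induces the Weyl group action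
  (\<open>sbar_conj\<close>, \<open>weyl_word_conj\<close>): an element of the coset of a word is a product of simple
  representatives interlaced with elements of \<open>H\<close>, and the latter act trivially on \<open>Lie H\<close>.
\<close>

section \<open>The matrix exponential\<close>

lemma matrix_mult_entry: "(A ** B) $ i $ j = (\<Sum>k\<in>UNIV. A $ i $ k * B $ k $ j)"
  by (simp add: matrix_matrix_mult_def)

lemma cscale_entry: "(c *\<^sub>C A) $ i $ j = c * A $ i $ j"
  by (simp add: cscale_def)

lemma cscale_mult_left: "(c *\<^sub>C A) ** B = c *\<^sub>C (A ** B)"
  by (simp add: vec_eq_iff matrix_mult_entry cscale_entry sum_distrib_left mult.assoc)

lemma cscale_mult_right: "A ** (c *\<^sub>C B) = c *\<^sub>C (A ** B)"
  by (simp add: vec_eq_iff matrix_mult_entry cscale_entry sum_distrib_left mult.assoc mult.left_commute)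

lemma matrix_mult_linear:
  fixes A B :: "complex^'n^'n"
  shows "A ** (B + C) = A ** B + A ** C" "(B + C) ** A = B ** A + C ** A"
    "A ** (B - C) = A ** B - A ** C" "(B - C) ** A = B ** A - C ** A"
    "A ** (- B) = - (A ** B)" "(- B) ** A = - (B ** A)"
  by (simp_all add: vec_eq_iff matrix_mult_entry sum.distrib sum_negf sum_subtractf algebra_simps)

lemma matrix_inv_eqI:
  fixes A B :: "complex^'n^'n"
  assumes "A ** B = mat 1"
  shows "matrix_inv A = B"
proof -
  have BA: "B ** A = mat 1"
    using assms by (rule matrix_left_right_inverse1)
  have "invertible A"
    using assms BA unfolding invertible_def by blast
  then have "matrix_inv A ** A = mat 1"
    unfolding invertible_def matrix_inv_def by (rule someI2_ex) simp
  then have "matrix_inv A ** A ** B = B"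
    by simp
  then show ?thesis
    by (simp add: matrix_mul_assoc [symmetric] assms)
qed

lemma matrix_inv_mult:
  fixes A B :: "complex^'n^'n"
  assumes "A ** matrix_inv A = mat 1" "B ** matrix_inv B = mat 1"
  shows "matrix_inv (A ** B) = matrix_inv B ** matrix_inv A"
proof (rule matrix_inv_eqI)
  have "A ** B ** (matrix_inv B ** matrix_inv A) = A ** (B ** matrix_inv B) ** matrix_inv A"
    by (simp add: matrix_mul_assoc)
  then show "A ** B ** (matrix_inv B ** matrix_inv A) = mat 1"
    using assms by simp
qed

lemma mpow_0: "mpow A 0 = mat 1"
  by (simp add: mpow_def)

lemma mpow_Suc: "mpow A (Suc k) = A ** mpow A k"
  by (simp add: mpow_def)

lemma mpow_Suc': "mpow A (Suc k) = mpow A k ** A"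
proof (induction k)
  case 0
  then show ?case by (simp add: mpow_def)
next
  case (Suc k)
  have "mpow A (Suc (Suc k)) = A ** (mpow A k ** A)"
    by (metis Suc mpow_Suc)
  then show ?case
    by (simp add: matrix_mul_assoc mpow_Suc)
qed

lemma mpow_cscale: "mpow (c *\<^sub>C A) k = c ^ k *\<^sub>C mpow A k"
  by (induction k) (simp_all add: mpow_0 mpow_Suc cscale_mult_left cscale_mult_right)

lemma mpow_conj:
  fixes A B X :: "complex^'n^'n"
  assumes "B ** A = mat 1"
  shows "mpow (A ** X ** B) k = A ** mpow X k ** B"
proof (induction k)
  case 0
  have "A ** B = mat 1"
    using assms by (rule matrix_left_right_inverse1)
  then show ?case by (simp add: mpow_0)
next
  case (Suc k)
  have "mpow (A ** X ** B) (Suc k) = A ** X ** (B ** A) ** mpow X k ** B"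
    by (simp add: mpow_Suc Suc matrix_mul_assoc)
  then show ?case
    by (simp add: assms mpow_Suc matrix_mul_assoc)
qed

text \<open>The sum of the norms of all entries serves as a submultiplicative bound; it makes every entry of
  the exponential an everywhere convergent power series in the parameter.\<close>

lemma norm_mpow_entry_le:
  fixes A :: "complex^'n^'n"
  shows "norm (mpow A k $ i $ j) \<le> (\<Sum>i\<in>UNIV. \<Sum>j\<in>UNIV. norm (A $ i $ j)) ^ k"
    (is "_ \<le> ?M ^ k")
proof (induction k arbitrary: i)
  case 0
  then show ?case by (simp add: mpow_0 mat_def)
next
  case (Suc k)
  have M: "0 \<le> ?M"
    by (intro sum_nonneg) simp
  have row: "(\<Sum>l\<in>UNIV. norm (A $ i $ l)) \<le> ?M"
    by (rule member_le_sum [where f = "\<lambda>i. \<Sum>j\<in>UNIV. norm (A $ i $ j)"])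
       (auto intro: sum_nonneg)
  have "norm (mpow A (Suc k) $ i $ j) \<le> (\<Sum>l\<in>UNIV. norm (A $ i $ l * mpow A k $ l $ j))"
    unfolding mpow_Suc matrix_mult_entry by (rule norm_sum)
  also have "\<dots> \<le> (\<Sum>l\<in>UNIV. norm (A $ i $ l) * ?M ^ k)"
    using Suc by (intro sum_mono) (simp add: norm_mult mult_left_mono)
  also have "\<dots> = (\<Sum>l\<in>UNIV. norm (A $ i $ l)) * ?M ^ k"
    by (simp add: sum_distrib_right)
  also have "\<dots> \<le> ?M * ?M ^ k"
    using row M by (intro mult_right_mono) simp_all
  finally show ?case by simp
qed

lemma mexp_entry_summable:
  fixes A :: "complex^'n^'n"
  shows "summable (\<lambda>k. mpow A k $ i $ j / fact k * t ^ k)"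
proof (rule summable_comparison_test')
  let ?M = "\<Sum>i\<in>UNIV. \<Sum>j\<in>UNIV. norm (A $ i $ j)"
  show "summable (\<lambda>k. inverse (fact k) * (?M * norm t) ^ k)"
    by (rule summable_exp)
  fix k :: nat
  have "norm (mpow A k $ i $ j / fact k * t ^ k)
          = norm (mpow A k $ i $ j) * norm t ^ k / fact k"
    by (simp add: norm_mult norm_divide norm_power)
  also have "\<dots> \<le> ?M ^ k * norm t ^ k / fact k"
    by (intro divide_right_mono mult_right_mono norm_mpow_entry_le) simp_all
  also have "\<dots> = inverse (fact k) * (?M * norm t) ^ k"
    by (simp add: power_mult_distrib field_simps)
  finally show "norm (mpow A k $ i $ j / fact k * t ^ k) \<le> inverse (fact k) * (?M * norm t) ^ k" .
qed

lemma mexp_entry_sums: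
  fixes A :: "complex^'n^'n"
  shows "(\<lambda>k. mpow A k $ i $ j / fact k) sums (mexp A $ i $ j)"
proof -
  let ?f = "\<lambda>k. (1 / fact k) *\<^sub>R mpow A k"
  define L where "L = (\<chi> i j. \<Sum>k. mpow A k $ i $ j / fact k)"
  have ent: "?f k $ i $ j = mpow A k $ i $ j / fact k" for k i j
    by (simp add: scaleR_conv_of_real [where 'a = complex])
  have s: "(\<lambda>k. mpow A k $ i $ j / fact k) sums (L $ i $ j)" for i j
    using mexp_entry_summable [of A i j 1] by (simp add: L_def summable_sums)
  have "?f sums L"
    unfolding sums_def
  proof (intro vec_tendstoI)
    fix i j
    show "(\<lambda>n. (\<Sum>k<n. ?f k) $ i $ j) \<longlonglongrightarrow> L $ i $ j"
      using s [of i j] by (simp add: sums_def ent del: vector_scaleR_component)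
  qed
  then have "mexp A = L"
    unfolding mexp_def by (rule sums_unique [symmetric])
  then show ?thesis using s by simp
qed

lemma mexp_scale_entry:
  "mexp (t *\<^sub>C A) $ i $ j = (\<Sum>k. mpow A k $ i $ j / fact k * t ^ k)"
  using sums_unique [OF mexp_entry_sums [of "t *\<^sub>C A" i j]]
  by (simp add: mpow_cscale cscale_entry mult.commute)

lemma mexp_0: "mexp 0 = (mat 1 :: complex^'n^'n)"
proof -
  have "mexp 0 $ i $ j = (mat 1 :: complex^'n^'n) $ i $ j" for i j
  proof -
    have "mexp (0 *\<^sub>C (0::complex^'n^'n)) $ i $ j = mpow 0 0 $ i $ j / fact 0"
      unfolding mexp_scale_entry by (rule powser_zero)
    then show ?thesis by (simp add: mpow_0)
  qed
  then show ?thesis by (simp add: vec_eq_iff)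
qed

lemma mexp_conj:
  fixes A B X :: "complex^'n^'n"
  assumes "B ** A = mat 1"
  shows "A ** mexp X ** B = mexp (A ** X ** B)"
proof -
  have "(A ** mexp X ** B) $ i $ j = mexp (A ** X ** B) $ i $ j" for i j
  proof -
    have "(\<lambda>k. \<Sum>q\<in>UNIV. (\<Sum>p\<in>UNIV. A $ i $ p * (mpow X k $ p $ q / fact k)) * B $ q $ j)
            sums ((A ** mexp X ** B) $ i $ j)"
      unfolding matrix_mult_entry
      by (intro sums_sum sums_mult sums_mult2 mexp_entry_sums)
    also have "(\<lambda>k. \<Sum>q\<in>UNIV. (\<Sum>p\<in>UNIV. A $ i $ p * (mpow X k $ p $ q / fact k)) * B $ q $ j)
               = (\<lambda>k. mpow (A ** X ** B) k $ i $ j / fact k)"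
      by (rule ext) (simp add: mpow_conj [OF assms] matrix_mult_entry sum_divide_distrib sum_distrib_right)
    finally show ?thesis
      using mexp_entry_sums sums_unique2 by blast
  qed
  then show ?thesis by (simp add: vec_eq_iff)
qed


text \<open>Differentiating matrices entry by entry avoids choosing a submultiplicative norm.\<close>

definition has_entrywise_derivative ::
    "(complex \<Rightarrow> complex^'n^'n) \<Rightarrow> complex^'n^'n \<Rightarrow> complex \<Rightarrow> bool"
  where "has_entrywise_derivative f f' t \<longleftrightarrow>
           (\<forall>i j. ((\<lambda>t. f t $ i $ j) has_field_derivative f' $ i $ j) (at t))"

lemma has_entrywise_derivative_mexp:
  "has_entrywise_derivative (\<lambda>t. mexp (t *\<^sub>C X)) (mexp (t *\<^sub>C X) ** X) t"
  unfolding has_entrywise_derivative_def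
proof (intro allI)
  fix i j
  let ?c = "\<lambda>j k. mpow X k $ i $ j / fact k"
  have "((\<lambda>t. mexp (t *\<^sub>C X) $ i $ j) has_field_derivative (\<Sum>k. diffs (?c j) k * t ^ k)) (at t)"
    unfolding mexp_scale_entry
    by (rule termdiffs_strong_converges_everywhere) (rule mexp_entry_summable)
  moreover have "(\<lambda>k. diffs (?c j) k * t ^ k) sums ((mexp (t *\<^sub>C X) ** X) $ i $ j)"
  proof -
    have "(\<lambda>k. \<Sum>l\<in>UNIV. (?c l k * t ^ k) * X $ l $ j) sums ((mexp (t *\<^sub>C X) ** X) $ i $ j)"
      unfolding matrix_mult_entry mexp_scale_entry
      by (intro sums_sum sums_mult2 summable_sums mexp_entry_summable)
    also have "(\<lambda>k. \<Sum>l\<in>UNIV. (?c l k * t ^ k) * X $ l $ j) = (\<lambda>k. diffs (?c j) k * t ^ k)"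
    proof
      fix k
      have "diffs (?c j) k = (mpow X k ** X) $ i $ j / fact k"
        by (simp add: diffs_def mpow_Suc' field_simps del: of_nat_Suc)
      then show "(\<Sum>l\<in>UNIV. (?c l k * t ^ k) * X $ l $ j) = diffs (?c j) k * t ^ k"
        by (simp add: matrix_mult_entry sum_divide_distrib sum_distrib_right sum_distrib_left mult_ac)
    qed
    finally show ?thesis .
  qed
  ultimately show "((\<lambda>t. mexp (t *\<^sub>C X) $ i $ j) has_field_derivative
      (mexp (t *\<^sub>C X) ** X) $ i $ j) (at t)"
    by (simp add: sums_iff)
qed

lemma mexp_commute: "mexp X ** X = X ** mexp (X :: complex^'n^'n)"
proof -
  have "(mexp X ** X) $ i $ j = (X ** mexp X) $ i $ j" for i j
  proof -
    have "(\<lambda>k. \<Sum>q\<in>UNIV. (mpow X k $ i $ q / fact k) * X $ q $ j) sums ((mexp X ** X) $ i $ j)"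
      unfolding matrix_mult_entry by (intro sums_sum sums_mult2 mexp_entry_sums)
    moreover have "(\<lambda>k. \<Sum>q\<in>UNIV. X $ i $ q * (mpow X k $ q $ j / fact k))
        sums ((X ** mexp X) $ i $ j)"
      unfolding matrix_mult_entry by (intro sums_sum sums_mult mexp_entry_sums)
    moreover have "(\<Sum>q\<in>UNIV. (mpow X k $ i $ q / fact k) * X $ q $ j)
        = (\<Sum>q\<in>UNIV. X $ i $ q * (mpow X k $ q $ j / fact k))" for k
    proof -
      have "(mpow X k ** X) $ i $ j = (X ** mpow X k) $ i $ j"
        using mpow_Suc [of X k] mpow_Suc' [of X k] by simp
      then show ?thesis
        by (simp add: matrix_mult_entry flip: sum_divide_distrib)
    qed
    ultimately show ?thesis
      using sums_unique2 by force
  qed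
  then show ?thesis by (simp add: vec_eq_iff)
qed

lemma has_entrywise_derivative_mult:
  assumes "has_entrywise_derivative f f' t" "has_entrywise_derivative g g' t"
  shows "has_entrywise_derivative (\<lambda>t. f t ** g t) (f' ** g t + f t ** g') t"
  using assms unfolding has_entrywise_derivative_def matrix_mult_entry vector_add_component
    sum.distrib [symmetric]
  by (auto intro!: DERIV_sum derivative_eq_intros simp: mult_ac)

lemma has_entrywise_derivative_zero_constant:
  assumes "\<And>t. has_entrywise_derivative f 0 t"
  shows "f s = f t"
proof -
  have "f s $ i $ j = f t $ i $ j" for i j
    using has_field_derivative_zero_constant [of UNIV "\<lambda>t. f t $ i $ j"] assms
    unfolding has_entrywise_derivative_def by fastforce
  then show ?thesis by (simp add: vec_eq_iff)
qed

lemma mexp_scale_commute: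
  fixes X :: "complex^'n^'n"
  shows "mexp (t *\<^sub>C X) ** X = X ** mexp (t *\<^sub>C X)"
proof (cases "t = 0")
  case True
  then show ?thesis by (simp add: mexp_0)
next
  case False
  have "inverse t *\<^sub>C (mexp (t *\<^sub>C X) ** (t *\<^sub>C X)) = inverse t *\<^sub>C ((t *\<^sub>C X) ** mexp (t *\<^sub>C X))"
    by (simp add: mexp_commute)
  with False show ?thesis by (simp add: cscale_mult_left cscale_mult_right)
qed

text \<open>The left side is constant in \<open>t\<close>: for \<open>W t = Y + t Z + t\<^sup>2/2 Z'\<close>, the coefficient
  hypotheses say \<open>W' = [X, W]\<close>, which cancels the derivatives of the two exponentials.\<close>

lemma mexp_intertwine:
  fixes X Y Z Z' :: "complex^'n^'n"
  assumes "bracket X Y = Z" "bracket X Z = Z'" "bracket X Z' = 0"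
  shows "mexp (- t *\<^sub>C X) ** (Y + t *\<^sub>C Z + (t\<^sup>2 / 2) *\<^sub>C Z') ** mexp (t *\<^sub>C X) = Y"
proof -
  define W where "W t = Y + t *\<^sub>C Z + (t\<^sup>2 / 2) *\<^sub>C Z'" for t
  have W': "has_entrywise_derivative W (Z + t *\<^sub>C Z') t" for t
    unfolding has_entrywise_derivative_def W_def
    by (auto simp: cscale_entry intro!: derivative_eq_intros)
  have br: "Z + t *\<^sub>C Z' = X ** W t - W t ** X" for t
  proof -
    have "X ** W t - W t ** X
            = bracket X Y + t *\<^sub>C bracket X Z + (t\<^sup>2 / 2) *\<^sub>C bracket X Z'"
      by (simp add: W_def bracket_def matrix_mult_linear
          cscale_mult_left cscale_mult_right cmat.scale_right_diff_distrib)
    then show ?thesis by (simp add: assms)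
  qed
  have E: "has_entrywise_derivative (\<lambda>t. mexp (- t *\<^sub>C X)) (- (mexp (- t *\<^sub>C X) ** X)) t" for t
  proof -
    have "((\<lambda>s. mexp (s *\<^sub>C X) $ i $ j) has_field_derivative (mexp (- t *\<^sub>C X) ** X) $ i $ j)
        (at (- t))" for i j
      using has_entrywise_derivative_mexp [of X "- t"]
      by (simp add: has_entrywise_derivative_def)
    then have "((\<lambda>s. mexp (- s *\<^sub>C X) $ i $ j) has_field_derivative
        (mexp (- t *\<^sub>C X) ** X) $ i $ j * (- 1)) (at t)" for i j
      by (rule DERIV_chain2) (auto intro!: derivative_eq_intros)
    then show ?thesis by (simp add: has_entrywise_derivative_def)
  qed
  let ?E = "\<lambda>t. mexp (t *\<^sub>C X)"
  have "has_entrywise_derivative (\<lambda>t. ?E (- t) ** W t ** ?E t) 0 t" for t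
  proof -
    have "has_entrywise_derivative (\<lambda>t. ?E (- t) ** W t ** ?E t)
        ((- (?E (- t) ** X) ** W t + ?E (- t) ** (Z + t *\<^sub>C Z')) ** ?E t
          + ?E (- t) ** W t ** (?E t ** X)) t"
      by (intro has_entrywise_derivative_mult E W' has_entrywise_derivative_mexp)
    moreover have "(- (?E (- t) ** X) ** W t + ?E (- t) ** (Z + t *\<^sub>C Z')) ** ?E t
          + ?E (- t) ** W t ** (?E t ** X) = 0"
      unfolding br mexp_scale_commute [of t X]
      by (simp add: matrix_mult_linear matrix_mul_assoc)
    ultimately show ?thesis by simp
  qed
  then have "?E (- t) ** W t ** ?E t = ?E (- 0) ** W 0 ** ?E 0"
    by (rule has_entrywise_derivative_zero_constant [where f = "\<lambda>t. ?E (- t) ** W t ** ?E t"])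
  then show ?thesis by (simp add: W_def mexp_0)
qed

lemma mexp_minus:
  fixes X :: "complex^'n^'n"
  shows "mexp (- X) ** mexp X = mat 1" "mexp X ** mexp (- X) = mat 1"
proof -
  show "mexp (- X) ** mexp X = mat 1"
    using mexp_intertwine [of X "mat 1" 0 0 1] by (simp add: bracket_def)
  then show "mexp X ** mexp (- X) = mat 1"
    by (rule matrix_left_right_inverse1)
qed

text \<open>The adjoint action of an exponential is the exponential series of \<open>bracket X\<close>, which stops after
  the quadratic term for the pairs that occur in \<open>sl\<^sub>2\<close>-strings of length at most three.\<close>

lemma Ad_mexp:
  fixes X Y Z Z' :: "complex^'n^'n"
  assumes "bracket X Y = Z" "bracket X Z = Z'" "bracket X Z' = 0"
  shows "mexp X ** Y ** mexp (- X) = Y + Z + (1 / 2) *\<^sub>C Z'"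
proof -
  have "mexp (- X) ** (Y + Z + (1 / 2) *\<^sub>C Z') ** mexp X = Y"
    using mexp_intertwine [OF assms, of 1] by simp
  then have "mexp X ** Y ** mexp (- X)
      = mexp X ** (mexp (- X) ** (Y + Z + (1 / 2) *\<^sub>C Z') ** mexp X) ** mexp (- X)"
    by (simp only:)
  also have "\<dots> = (mexp X ** mexp (- X)) ** (Y + Z + (1 / 2) *\<^sub>C Z') ** (mexp X ** mexp (- X))"
    by (simp only: matrix_mul_assoc)
  finally show ?thesis by (simp add: mexp_minus)
qed


section \<open>Derivations of polynomial functions and ordered words\<close>

lemma polynomial_functions_sum:
  assumes "finite S" "\<And>k. k \<in> S \<Longrightarrow> f k \<in> polynomial_functions"
  shows "(\<lambda>A. \<Sum>k\<in>S. f k A) \<in> polynomial_functions"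
  using assms by (induction S) (auto intro: polynomial_functions.intros)

lemma polynomial_functions_entry_mult:
  "(\<lambda>A. (A ** X) $ i $ j) \<in> polynomial_functions"
  "(\<lambda>A. (X ** A) $ i $ j) \<in> polynomial_functions"
  unfolding matrix_mult_entry
  by (intro polynomial_functions_sum polynomial_functions.intros; simp)+

lemma polynomial_functions_translate:
  "p \<in> polynomial_functions \<Longrightarrow> (\<lambda>A. p (B ** A)) \<in> polynomial_functions"
  by (induction rule: polynomial_functions.induct)
     (auto intro: polynomial_functions.intros polynomial_functions_entry_mult)

text \<open>The left invariant vector field of \<open>X\<close>, acting on functions.\<close>

definition rderiv ::
    "complex^'n^'n \<Rightarrow> (complex^'n^'n \<Rightarrow> complex) \<Rightarrow> complex^'n^'n \<Rightarrow> complex"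
  where "rderiv X p A = deriv (\<lambda>t. p (A ** mexp (t *\<^sub>C X))) 0"

lemma rderiv_eqI:
  assumes "\<And>A t. ((\<lambda>t. p (A ** mexp (t *\<^sub>C X))) has_field_derivative q (A ** mexp (t *\<^sub>C X))) (at t)"
  shows "rderiv X p = q"
proof
  fix A
  show "rderiv X p A = q A"
    unfolding rderiv_def using DERIV_imp_deriv [OF assms [of A 0]] by (simp add: mexp_0)
qed

lemma entry_along_mexp:
  fixes A X :: "complex^'n^'n"
  shows "((\<lambda>t. (A ** mexp (t *\<^sub>C X)) $ i $ j) has_field_derivative
     (A ** mexp (t *\<^sub>C X) ** X) $ i $ j) (at t)"
proof -
  have "has_entrywise_derivative (\<lambda>t. A ** mexp (t *\<^sub>C X))
          (0 ** mexp (t *\<^sub>C X) + A ** (mexp (t *\<^sub>C X) ** X)) t"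
    by (intro has_entrywise_derivative_mult has_entrywise_derivative_mexp)
       (simp add: has_entrywise_derivative_def)
  moreover have "0 ** mexp (t *\<^sub>C X) = 0"
    by (simp add: vec_eq_iff matrix_mult_entry)
  ultimately show ?thesis
    by (simp add: has_entrywise_derivative_def matrix_mul_assoc)
qed

text \<open>The derivative along a curve \<open>A exp (t X)\<close> is a polynomial function of the moving point, not just
  of \<open>A\<close>; this is what allows derivations to be iterated.\<close>

lemma rderiv_exists:
  assumes "p \<in> polynomial_functions"
  shows "\<exists>q\<in>polynomial_functions. \<forall>A t.
           ((\<lambda>t. p (A ** mexp (t *\<^sub>C X))) has_field_derivative q (A ** mexp (t *\<^sub>C X))) (at t)"
  using assms
proof (induction rule: polynomial_functions.induct)
  case (const c)
  then show ?case
    by (intro bexI [of _ "\<lambda>A. 0"]) (auto intro: polynomial_functions.const)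
next
  case (entry i j)
  then show ?case
    by (intro bexI [of _ "\<lambda>A. (A ** X) $ i $ j"])
       (auto intro: polynomial_functions_entry_mult entry_along_mexp)
next
  case (add p q)
  then obtain p' q' where
      "p' \<in> polynomial_functions" "q' \<in> polynomial_functions"
      "\<And>A t. ((\<lambda>t. p (A ** mexp (t *\<^sub>C X))) has_field_derivative p' (A ** mexp (t *\<^sub>C X))) (at t)"
      "\<And>A t. ((\<lambda>t. q (A ** mexp (t *\<^sub>C X))) has_field_derivative q' (A ** mexp (t *\<^sub>C X))) (at t)"
    by blast
  then show ?case
    by (intro bexI [of _ "\<lambda>A. p' A + q' A"])
       (auto intro!: polynomial_functions.intros derivative_intros)
next
  case (mult p q)
  then obtain p' q' where
      "p' \<in> polynomial_functions" "q' \<in> polynomial_functions"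
      "\<And>A t. ((\<lambda>t. p (A ** mexp (t *\<^sub>C X))) has_field_derivative p' (A ** mexp (t *\<^sub>C X))) (at t)"
      "\<And>A t. ((\<lambda>t. q (A ** mexp (t *\<^sub>C X))) has_field_derivative q' (A ** mexp (t *\<^sub>C X))) (at t)"
    by blast
  with mult.hyps show ?case
    by (intro bexI [of _ "\<lambda>A. p' A * q A + p A * q' A"])
       (auto intro!: polynomial_functions.intros derivative_eq_intros)
qed

lemma
  assumes "p \<in> polynomial_functions"
  shows rderiv_polynomial: "rderiv X p \<in> polynomial_functions"
    and rderiv_along_mexp: "((\<lambda>t. p (A ** mexp (t *\<^sub>C X))) has_field_derivative
           rderiv X p (A ** mexp (t *\<^sub>C X))) (at t)"
  using rderiv_exists [OF assms, of X] rderiv_eqI [of p X] by force+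

lemma rderiv_const: "rderiv X (\<lambda>A. c) = (\<lambda>A. 0)"
  by (intro rderiv_eqI) simp

lemma rderiv_entry: "rderiv X (\<lambda>A. A $ i $ j) = (\<lambda>A. (A ** X) $ i $ j)"
  by (intro rderiv_eqI entry_along_mexp)

lemma rderiv_add:
  assumes "p \<in> polynomial_functions" "q \<in> polynomial_functions"
  shows "rderiv X (\<lambda>A. p A + q A) = (\<lambda>A. rderiv X p A + rderiv X q A)"
  using assms by (intro rderiv_eqI derivative_intros rderiv_along_mexp)

lemma rderiv_mult:
  assumes "p \<in> polynomial_functions" "q \<in> polynomial_functions"
  shows "rderiv X (\<lambda>A. p A * q A) = (\<lambda>A. rderiv X p A * q A + p A * rderiv X q A)"
  using rderiv_along_mexp [OF assms(1)] rderiv_along_mexp [OF assms(2)]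
  by (intro rderiv_eqI) (auto intro!: derivative_eq_intros)

lemma rderiv_entry_mult: "rderiv X (\<lambda>A. (A ** Y) $ i $ j) = (\<lambda>A. (A ** X ** Y) $ i $ j)"
proof (rule rderiv_eqI)
  fix A t
  have "((\<lambda>t. \<Sum>k\<in>UNIV. (A ** mexp (t *\<^sub>C X)) $ i $ k * Y $ k $ j) has_field_derivative
        (\<Sum>k\<in>UNIV. (A ** mexp (t *\<^sub>C X) ** X) $ i $ k * Y $ k $ j)) (at t)"
    by (intro DERIV_sum DERIV_cmult_right entry_along_mexp)
  then show "((\<lambda>t. (A ** mexp (t *\<^sub>C X) ** Y) $ i $ j) has_field_derivative
        (A ** mexp (t *\<^sub>C X) ** X ** Y) $ i $ j) (at t)"
    by (simp add: matrix_mult_entry [of _ Y])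
qed

text \<open>Both sides are derivations in \<open>p\<close>, so it is enough to compare them on matrix entries, where
  \<open>rderiv X\<close> is right multiplication by \<open>X\<close>.\<close>

lemma rderiv_commutator:
  assumes "p \<in> polynomial_functions"
  shows "rderiv X (rderiv Y p) = (\<lambda>A. rderiv Y (rderiv X p) A + rderiv (bracket X Y) p A)"
  using assms
proof (induction rule: polynomial_functions.induct)
  case (const c)
  then show ?case by (simp add: rderiv_const)
next
  case (entry i j)
  then show ?case
    by (simp add: rderiv_entry rderiv_entry_mult bracket_def matrix_mult_linear matrix_mul_assoc)
next
  case (add p q)
  then show ?case
    by (simp add: rderiv_add rderiv_polynomial algebra_simps)
next
  case (mult p q)
  then show ?case
    by (simp add: rderiv_add rderiv_mult rderiv_polynomial polynomial_functions.mult algebra_simps)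
qed

lemma rderiv_word_polynomial:
  "p \<in> polynomial_functions \<Longrightarrow> foldr rderiv Xs p \<in> polynomial_functions"
  by (induction Xs) (simp_all add: rderiv_polynomial)

lemma rderiv_word_add:
  assumes "p \<in> polynomial_functions" "q \<in> polynomial_functions"
  shows "foldr rderiv Xs (\<lambda>A. p A + q A) = (\<lambda>A. foldr rderiv Xs p A + foldr rderiv Xs q A)"
  using assms by (induction Xs) (simp_all add: rderiv_add rderiv_word_polynomial)

lemma rderiv_word_commutator:
  assumes "p \<in> polynomial_functions"
  shows "foldr rderiv (u @ X # Y # v) p A
           = foldr rderiv (u @ Y # X # v) p A + foldr rderiv (u @ bracket X Y # v) p A"
  using assms
  by (simp add: rderiv_commutator [of _ X Y] rderiv_word_add rderiv_word_polynomial rderiv_polynomial)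

definition mexp_prod :: "(complex^'n^'n) list \<Rightarrow> complex^'n^'n"
  where "mexp_prod Xs = foldr (\<lambda>X A. mexp X ** A) Xs (mat 1)"

lemma mexp_prod_simps [simp]:
  "mexp_prod [] = mat 1" "mexp_prod (X # Xs) = mexp X ** mexp_prod Xs"
  by (simp_all add: mexp_prod_def)

lemma mexp_prod_append: "mexp_prod (Xs @ Ys) = mexp_prod Xs ** mexp_prod Ys"
  by (induction Xs) (simp_all add: matrix_mul_assoc)

text \<open>A word of derivations at \<open>A\<close> is a mixed first order partial derivative of
  \<open>(t\<^sub>1, \<dots>, t\<^sub>n) \<mapsto> p (A exp (t\<^sub>1 X\<^sub>1) \<cdots> exp (t\<^sub>n X\<^sub>n))\<close> at the origin.\<close>

lemma rderiv_word_eq_0: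
  assumes "p \<in> polynomial_functions"
    and "\<And>Ys. list_all2 (\<lambda>X Y. \<exists>t. Y = t *\<^sub>C X) Xs Ys \<Longrightarrow> p (A ** mexp_prod Ys) = 0"
  shows "foldr rderiv Xs p A = 0"
  using assms(2)
proof (induction Xs arbitrary: A)
  case Nil
  from Nil [of "[]"] show ?case by simp
next
  case (Cons X Xs)
  have "foldr rderiv Xs p (A ** mexp (t *\<^sub>C X)) = 0" for t
  proof (rule Cons.IH)
    fix Ys
    assume "list_all2 (\<lambda>X Y. \<exists>t. Y = t *\<^sub>C X) Xs Ys"
    then show "p (A ** mexp (t *\<^sub>C X) ** mexp_prod Ys) = 0"
      using Cons.prems [of "t *\<^sub>C X # Ys"] by (auto simp: matrix_mul_assoc)
  qed
  then show ?case by (simp add: rderiv_def [of X])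
qed

lemma deriv_iterate_along_mexp:
  assumes "p \<in> polynomial_functions"
  shows "(deriv ^^ n) (\<lambda>t. p (A ** mexp (t *\<^sub>C X)))
           = (\<lambda>t. foldr rderiv (replicate n X) p (A ** mexp (t *\<^sub>C X)))"
proof (induction n)
  case (Suc n)
  show ?case
  proof
    fix t
    show "(deriv ^^ Suc n) (\<lambda>t. p (A ** mexp (t *\<^sub>C X))) t
            = foldr rderiv (replicate (Suc n) X) p (A ** mexp (t *\<^sub>C X))"
      using DERIV_imp_deriv [OF rderiv_along_mexp
          [OF rderiv_word_polynomial [OF assms, of "replicate n X"], where X = X]]
      by (simp add: Suc)
  qed
qed simp

text \<open>Moving the base point from \<open>A\<close> to \<open>A exp Y\<close> preserves the hypothesis: each word of derivations,
  followed along \<open>t \<mapsto> A exp (t Y)\<close>, is an entire function whose Taylor coefficients at \<open>0\<close> are given by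
  the words extended by copies of \<open>Y\<close>, and so it is identically zero.\<close>

lemma polynomial_eq_0_on_mexp_prod:
  assumes p: "p \<in> polynomial_functions"
    and "\<And>Xs. Xs \<in> lists S \<Longrightarrow> foldr rderiv Xs p A = 0"
    and "Ys \<in> lists S"
  shows "p (A ** mexp_prod Ys) = 0"
  using assms(2,3)
proof (induction Ys arbitrary: A)
  case Nil
  from Nil.prems(1) [of "[]"] show ?case by simp
next
  case (Cons Y Ys)
  have "foldr rderiv Xs p (A ** mexp Y) = 0" if Xs: "Xs \<in> lists S" for Xs
  proof -
    let ?q = "foldr rderiv Xs p"
    have q: "?q \<in> polynomial_functions"
      using p by (rule rderiv_word_polynomial)
    have "?q (A ** mexp (1 *\<^sub>C Y)) = 0"
    proof (rule holomorphic_fun_eq_0_on_connected 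
        [where f = "\<lambda>t. ?q (A ** mexp (t *\<^sub>C Y))" and S = UNIV and z = 0])
      show "(\<lambda>t. ?q (A ** mexp (t *\<^sub>C Y))) holomorphic_on UNIV"
        using rderiv_along_mexp [OF q] by (auto simp: holomorphic_on_open)
      fix n
      have "replicate n Y @ Xs \<in> lists S"
        using Xs Cons.prems(2) by auto
      then have "foldr rderiv (replicate n Y @ Xs) p A = 0"
        by (rule Cons.prems(1))
      then show "(deriv ^^ n) (\<lambda>t. ?q (A ** mexp (t *\<^sub>C Y))) 0 = 0"
        by (simp add: deriv_iterate_along_mexp [OF q] mexp_0)
    qed auto
    then show ?thesis by simp
  qed
  then have "p (A ** mexp Y ** mexp_prod Ys) = 0"
    using Cons.prems(2) by (intro Cons.IH) auto
  then show ?case by (simp add: matrix_mul_assoc)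
qed

text \<open>Exchanging two neighbouring letters costs a word that is shorter by one, which contributes
  nothing by hypothesis. Letters of the same kind are never exchanged, which is why the
  hypotheses are about brackets of different kinds.
  The prefix \<open>u\<close> is carried along for the induction on \<open>w\<close>.\<close>

lemma rderiv_word_sort:
  fixes F T E :: "(complex^'n^'n) set" and p A
  defines "L \<equiv> F \<union> T \<union> E"
  assumes p: "p \<in> polynomial_functions"
    and TF: "\<And>X Y. X \<in> T \<Longrightarrow> Y \<in> F \<Longrightarrow> bracket X Y \<in> L"
    and EF: "\<And>X Y. X \<in> E \<Longrightarrow> Y \<in> F \<Longrightarrow> bracket X Y \<in> L"
    and ET: "\<And>X Y. X \<in> E \<Longrightarrow> Y \<in> T \<Longrightarrow> bracket X Y \<in> L"
    and shorter: "\<And>ws. ws \<in> lists L \<Longrightarrow> length ws < n \<Longrightarrow> foldr rderiv ws p A = 0"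
    and "u \<in> lists L" "w \<in> lists L" "length u + length w = n"
  shows "\<exists>fs\<in>lists F. \<exists>ts\<in>lists T. \<exists>es\<in>lists E. length (fs @ ts @ es) = length w \<and>
           foldr rderiv (u @ w) p A = foldr rderiv (u @ fs @ ts @ es) p A"
proof -
  have move: "foldr rderiv (u @ X # ys @ v) p A = foldr rderiv (u @ ys @ X # v) p A"
    if S: "\<And>Y. Y \<in> S \<Longrightarrow> bracket X Y \<in> L" "S \<subseteq> L" and "X \<in> L" and ys: "ys \<in> lists S"
      and u: "u \<in> lists L" and v: "v \<in> lists L" and n: "length u + length ys + length v < n"
    for X ys S u v
    using ys u n
  proof (induction ys arbitrary: u)
    case (Cons Y ys)
    have "ys \<in> lists L"
      using Cons.hyps lists_mono [OF \<open>S \<subseteq> L\<close>] by blast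
    then have "foldr rderiv (u @ bracket X Y # ys @ v) p A = 0"
      using Cons.prems Cons.hyps S v by (intro shorter) auto
    then have "foldr rderiv (u @ X # (Y # ys) @ v) p A = foldr rderiv ((u @ [Y]) @ X # ys @ v) p A"
      using rderiv_word_commutator [OF p, of u X Y "ys @ v" A] by simp
    also have "\<dots> = foldr rderiv ((u @ [Y]) @ ys @ X # v) p A"
      using Cons.prems Cons.hyps \<open>S \<subseteq> L\<close> by (intro Cons.IH) auto
    finally show ?case by simp
  qed simp
  show ?thesis
    using assms(7-)
  proof (induction w arbitrary: u)
    case Nil
    then show ?case by (intro bexI [of _ "[]"]) auto
  next
    case (Cons X w)
    then have "\<exists>fs\<in>lists F. \<exists>ts\<in>lists T. \<exists>es\<in>lists E. length (fs @ ts @ es) = length w \<and>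
           foldr rderiv ((u @ [X]) @ w) p A = foldr rderiv ((u @ [X]) @ fs @ ts @ es) p A"
      by (intro Cons.IH) auto
    then obtain fs ts es where fs: "fs \<in> lists F" and ts: "ts \<in> lists T" and es: "es \<in> lists E"
      and len: "length (fs @ ts @ es) = length w"
      and eq: "foldr rderiv (u @ X # w) p A = foldr rderiv (u @ X # fs @ ts @ es) p A"
      by auto
    have L: "fs \<in> lists L" "ts \<in> lists L" "es \<in> lists L" "X \<in> L" "u \<in> lists L"
      using fs ts es Cons.prems by (auto simp: L_def)
    have n: "length u + length fs + length (ts @ es) < n"
      using Cons.prems len by simp
    have past_F: "foldr rderiv (u @ X # fs @ ts @ es) p A = foldr rderiv (u @ fs @ X # ts @ es) p A"
      if "X \<in> T \<union> E"
      using that L n fs TF EF by (intro move [of F]) (auto simp: L_def)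
    consider "X \<in> F" | "X \<in> T" | "X \<in> E"
      using Cons.prems by (auto simp: L_def)
    then show ?case
    proof cases
      case 1
      then show ?thesis
        using fs ts es len eq
        by (intro bexI [of _ "X # fs"] bexI [of _ ts] bexI [of _ es]) auto
    next
      case 2
      then show ?thesis
        using fs ts es len eq past_F
        by (intro bexI [of _ fs] bexI [of _ "X # ts"] bexI [of _ es]) auto
    next
      case 3
      have "foldr rderiv ((u @ fs) @ X # ts @ es) p A = foldr rderiv ((u @ fs) @ ts @ X # es) p A"
        using 3 L n ts ET by (intro move [of T]) (auto simp: L_def)
      with 3 show ?thesis
        using fs ts es len eq past_F
        by (intro bexI [of _ fs] bexI [of _ ts] bexI [of _ "X # es"]) auto
    qed
  qed
qed

text \<open>This replaces the density of the big cell. For \<open>F\<close>, \<open>T\<close>, \<open>E\<close> inside the Lie algebras of \<open>N\<^sub>-\<close>, \<open>H\<close>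
  and \<open>N\<close>, the products in the hypothesis lie in \<open>N\<^sub>- H N\<close>, while those in the conclusion may leave it.\<close>

lemma polynomial_vanishing_from_triangular_products:
  fixes F T E :: "(complex^'n^'n) set" and p
  defines "L \<equiv> F \<union> T \<union> E"
  assumes p: "p \<in> polynomial_functions"
    and brackets: "\<And>X Y. X \<in> T \<Longrightarrow> Y \<in> F \<Longrightarrow> bracket X Y \<in> L"
      "\<And>X Y. X \<in> E \<Longrightarrow> Y \<in> F \<Longrightarrow> bracket X Y \<in> L"
      "\<And>X Y. X \<in> E \<Longrightarrow> Y \<in> T \<Longrightarrow> bracket X Y \<in> L"
    and scale: "\<And>X t. X \<in> F \<Longrightarrow> t *\<^sub>C X \<in> F" "\<And>X t. X \<in> T \<Longrightarrow> t *\<^sub>C X \<in> T"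
      "\<And>X t. X \<in> E \<Longrightarrow> t *\<^sub>C X \<in> E"
    and zero: "\<And>fs ts es. fs \<in> lists F \<Longrightarrow> ts \<in> lists T \<Longrightarrow> es \<in> lists E \<Longrightarrow>
      p (mexp_prod fs ** mexp_prod ts ** mexp_prod es) = 0"
    and Ys: "Ys \<in> lists L"
  shows "p (mexp_prod Ys) = 0"
proof -
  have scaled: "Ys \<in> lists S"
    if "list_all2 (\<lambda>X Y. \<exists>t. Y = t *\<^sub>C X) Xs Ys" "Xs \<in> lists S"
      "\<And>X t. X \<in> S \<Longrightarrow> t *\<^sub>C X \<in> S"
    for Xs Ys and S :: "(complex^'n^'n) set"
    using that(1,2) by induction (auto simp: that(3))
  have ordered: "foldr rderiv (fs @ ts @ es) p (mat 1) = 0"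
    if "fs \<in> lists F" "ts \<in> lists T" "es \<in> lists E" for fs ts es
  proof (rule rderiv_word_eq_0 [OF p])
    fix Zs
    assume "list_all2 (\<lambda>X Y. \<exists>t. Y = t *\<^sub>C X) (fs @ ts @ es) Zs"
    then obtain fs' ts' es' where "Zs = fs' @ ts' @ es'"
        "list_all2 (\<lambda>X Y. \<exists>t. Y = t *\<^sub>C X) fs fs'" "list_all2 (\<lambda>X Y. \<exists>t. Y = t *\<^sub>C X) ts ts'"
        "list_all2 (\<lambda>X Y. \<exists>t. Y = t *\<^sub>C X) es es'"
      by (auto simp: list_all2_append1)
    with that scale show "p (mat 1 ** mexp_prod Zs) = 0"
      using zero [of fs' ts' es'] scaled by (auto simp: mexp_prod_append matrix_mul_assoc)
  qed
  have "foldr rderiv Xs p (mat 1) = 0" if "Xs \<in> lists L" for Xs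
    using that
  proof (induction "length Xs" arbitrary: Xs rule: less_induct)
    case less
    have "\<exists>fs\<in>lists F. \<exists>ts\<in>lists T. \<exists>es\<in>lists E. length (fs @ ts @ es) = length Xs \<and>
        foldr rderiv ([] @ Xs) p (mat 1) = foldr rderiv ([] @ fs @ ts @ es) p (mat 1)"
      by (rule rderiv_word_sort [where n = "length Xs"])
         (use p brackets less in \<open>auto simp: L_def\<close>)
    then show ?case using ordered by auto
  qed
  then have "p (mat 1 ** mexp_prod Ys) = 0"
    using Ys by (intro polynomial_eq_0_on_mexp_prod [OF p])
  then show ?thesis by simp
qed


section \<open>Algebraic groups, tori and normal subgroups of matrices\<close>

lemma matgrp_simps [simp]:
  "carrier (matgrp S) = S" "monoid.mult (matgrp S) = (**)" "one (matgrp S) = mat 1"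
  by (simp_all add: matgrp_def)

lemma matgrp_inverse:
  assumes "group (matgrp S)" "A \<in> S"
  shows "inv\<^bsub>matgrp S\<^esub> A = matrix_inv A" "matrix_inv A \<in> S"
    "A ** matrix_inv A = mat 1" "matrix_inv A ** A = mat 1"
proof -
  interpret group "matgrp S" by (rule assms)
  have r: "A ** inv\<^bsub>matgrp S\<^esub> A = mat 1"
    using r_inv [of A] assms(2) by simp
  then show eq: "inv\<^bsub>matgrp S\<^esub> A = matrix_inv A"
    by (rule matrix_inv_eqI [symmetric])
  show "matrix_inv A \<in> S"
    using inv_closed [of A] assms(2) eq by simp
  show "A ** matrix_inv A = mat 1"
    using r eq by simp
  then show "matrix_inv A ** A = mat 1"
    by (rule matrix_left_right_inverse1)
qed

lemma algebraic_group_group: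
  fixes K :: "(complex^'n^'n) set"
  assumes "algebraic_group K"
  shows "group (matgrp K)"
proof -
  have GL: "group (matgrp (GL :: (complex^'n^'n) set))"
  proof (rule groupI)
    fix A :: "complex^'n^'n" assume "A \<in> carrier (matgrp GL)"
    then show "\<exists>B\<in>carrier (matgrp GL). B \<otimes>\<^bsub>matgrp GL\<^esub> A = \<one>\<^bsub>matgrp GL\<^esub>"
      by (auto simp: GL_def invertible_def)
  next
    have "mat 1 ** mat 1 = (mat 1 :: complex^'n^'n)"
      by simp
    then show "\<one>\<^bsub>matgrp GL\<^esub> \<in> carrier (matgrp (GL :: (complex^'n^'n) set))"
      unfolding matgrp_simps GL_def invertible_def by blast
  qed (auto simp: GL_def matrix_mul_assoc invertible_mult)
  moreover have "subgroup K (matgrp GL)"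
    using assms by (simp add: algebraic_group_def)
  ultimately have "group ((matgrp GL) \<lparr>carrier := K\<rparr>)"
    by (intro group.subgroup_imp_group)
  then show ?thesis by (simp add: matgrp_def)
qed

lemma
  assumes "algebraic_group K"
  shows algebraic_group_one: "mat 1 \<in> K"
    and algebraic_group_mult: "A \<in> K \<Longrightarrow> B \<in> K \<Longrightarrow> A ** B \<in> K"
    and algebraic_group_invertible: "A \<in> K \<Longrightarrow> invertible A"
  using assms subgroup.one_closed [of K "matgrp GL"] subgroup.m_closed [of K "matgrp GL"]
  by (auto simp: algebraic_group_def GL_def)

lemma normal_matgrp_conj:
  assumes "U \<lhd> matgrp B" "A \<in> B" "u \<in> U"
  shows "A ** u ** matrix_inv A \<in> U"
proof -
  interpret normal U "matgrp B" by (rule assms)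
  have "A \<otimes>\<^bsub>matgrp B\<^esub> u \<otimes>\<^bsub>matgrp B\<^esub> inv\<^bsub>matgrp B\<^esub> A \<in> U"
    using assms by (intro inv_op_closed2) simp_all
  then show ?thesis
    using matgrp_inverse(1) [OF is_group assms(2)] by simp
qed

lemma torus_commute:
  fixes T :: "(complex^'n^'n) set"
  assumes "torus T" "A \<in> T" "B \<in> T"
  shows "A ** B = B ** A"
proof -
  obtain P :: "complex^'n^'n" where P: "invertible P"
    and diag: "\<And>A i j. A \<in> T \<Longrightarrow> i \<noteq> j \<Longrightarrow> (P ** A ** matrix_inv P) $ i $ j = 0"
    using assms(1) unfolding torus_def by metis
  obtain Q where PQ: "P ** Q = mat 1" and QP: "Q ** P = mat 1"
    using P by (auto simp: invertible_def)
  have Q: "matrix_inv P = Q"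
    using PQ by (rule matrix_inv_eqI)
  have prod_entry: "((P ** A ** Q) ** (P ** B ** Q)) $ i $ j
      = (if i = j then (P ** A ** Q) $ i $ i * (P ** B ** Q) $ i $ i else 0)"
    if "A \<in> T" "B \<in> T" for A B i j
  proof -
    have "((P ** A ** Q) ** (P ** B ** Q)) $ i $ j
        = (\<Sum>k\<in>UNIV. if k = i then (P ** A ** Q) $ i $ i * (P ** B ** Q) $ i $ j else 0)"
      unfolding matrix_mult_entry [of "P ** A ** Q"]
      using diag [OF that(1)] by (intro sum.cong) (auto simp: Q)
    then show ?thesis
      using diag [OF that(2)] by (auto simp: Q)
  qed
  have "(P ** A ** Q) ** (P ** B ** Q) = (P ** B ** Q) ** (P ** A ** Q)"
    using assms(2,3) by (simp add: vec_eq_iff prod_entry mult.commute)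
  moreover have "Q ** ((P ** A ** Q) ** (P ** B ** Q)) ** P = A ** B" for A B
  proof -
    have "Q ** ((P ** A ** Q) ** (P ** B ** Q)) ** P
        = (Q ** P) ** A ** (Q ** P) ** B ** (Q ** P)"
      by (simp add: matrix_mul_assoc)
    then show ?thesis by (simp add: QP)
  qed
  ultimately show ?thesis by metis
qed

text \<open>A diagonalizable nilpotent matrix is zero.\<close>

lemma torus_unipotent_eq_one:
  fixes T :: "(complex^'n^'n) set"
  assumes "torus T" "A \<in> T" "mpow (A - mat 1) k = 0"
  shows "A = mat 1"
proof -
  obtain P :: "complex^'n^'n" where P: "invertible P"
    and diag: "\<And>i j. i \<noteq> j \<Longrightarrow> (P ** A ** matrix_inv P) $ i $ j = 0"
    using assms(1,2) unfolding torus_def by metis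
  obtain Q where PQ: "P ** Q = mat 1" and QP: "Q ** P = mat 1"
    using P by (auto simp: invertible_def)
  have Q: "matrix_inv P = Q"
    using PQ by (rule matrix_inv_eqI)
  define M where "M = P ** (A - mat 1) ** Q"
  have M: "M $ i $ j = 0" if "i \<noteq> j" for i j
    using diag [OF that] that
    by (simp add: M_def matrix_mult_linear PQ Q) (simp add: mat_def)
  have "mpow M k $ i $ i = (M $ i $ i) ^ k" for k i
  proof (induction k)
    case (Suc k)
    have "mpow M (Suc k) $ i $ i = (\<Sum>l\<in>UNIV. if l = i then M $ i $ i * mpow M k $ i $ i else 0)"
      unfolding mpow_Suc matrix_mult_entry using M by (intro sum.cong) auto
    then show ?case by (simp add: Suc)
  qed (simp add: mpow_0 mat_def)
  moreover have "mpow M k = 0"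
    unfolding M_def mpow_conj [OF QP] assms(3) by (simp add: vec_eq_iff matrix_mult_entry)
  ultimately have "(M $ i $ i) ^ k = 0" for i
    by (metis zero_index)
  then have diag_0: "M $ i $ i = 0" for i
    by (meson power_not_zero)
  have "M $ i $ j = 0" for i j
    by (cases "i = j") (use M diag_0 in auto)
  then have "M = 0"
    by (simp add: vec_eq_iff)
  have "A - mat 1 = (Q ** P) ** (A - mat 1) ** (Q ** P)"
    by (simp add: QP)
  also have "\<dots> = Q ** M ** P"
    by (simp add: M_def matrix_mul_assoc)
  also have "\<dots> = 0"
    by (simp add: \<open>M = 0\<close> vec_eq_iff matrix_mult_entry)
  finally show ?thesis by simp
qed

lemma mexp_in_group:
  assumes "X \<in> Lie K"
  shows "mexp X \<in> K"
proof -
  have "mexp (1 *\<^sub>C X) \<in> K"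
    using assms unfolding Lie_def by blast
  then show ?thesis by simp
qed

lemma Lie_scale: "X \<in> Lie K \<Longrightarrow> c *\<^sub>C X \<in> Lie K"
  by (simp add: Lie_def)

lemma Lie_mono: "K \<subseteq> K' \<Longrightarrow> Lie K \<subseteq> Lie K'"
  by (auto simp: Lie_def)

lemma mexp_prod_in_group:
  assumes "algebraic_group K" "Xs \<in> lists (Lie K)"
  shows "mexp_prod Xs \<in> K"
  using assms(2)
  by induction (simp_all add: algebraic_group_one algebraic_group_mult assms(1) mexp_in_group)

text \<open>Differentiate \<open>b exp (t X) = exp (t X) b\<close>, an identity in the commutative group \<open>T\<close>.\<close>

lemma torus_fixes_Lie:
  assumes T: "torus T" and b: "b \<in> T" and X: "X \<in> Lie T"
  shows "b ** X = X ** b"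
proof -
  let ?E = "\<lambda>t. mexp (t *\<^sub>C X)"
  have const: "has_entrywise_derivative (\<lambda>t. b) 0 0"
    by (simp add: has_entrywise_derivative_def)
  have z: "0 ** M = 0" "M ** 0 = 0" for M :: "complex^'a^'a"
    by (simp_all add: vec_eq_iff matrix_mult_entry)
  have "has_entrywise_derivative (\<lambda>t. b ** ?E t) (b ** X) 0"
    using has_entrywise_derivative_mult [OF const has_entrywise_derivative_mexp [of X 0]]
    by (simp add: mexp_0 z)
  moreover have "has_entrywise_derivative (\<lambda>t. ?E t ** b) (X ** b) 0"
    using has_entrywise_derivative_mult [OF has_entrywise_derivative_mexp [of X 0] const]
    by (simp add: mexp_0 z)
  moreover have "(\<lambda>t. ?E t ** b) = (\<lambda>t. b ** ?E t)"
    using X b by (intro ext torus_commute [OF T]) (auto simp: Lie_def)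
  ultimately show ?thesis
    unfolding has_entrywise_derivative_def vec_eq_iff by (metis DERIV_unique)
qed

lemma bracket_linear:
  fixes X Y Z :: "complex^'n^'n"
  shows "bracket (X + Y) Z = bracket X Z + bracket Y Z"
    "bracket Z (X + Y) = bracket Z X + bracket Z Y"
    "bracket (c *\<^sub>C X) Z = c *\<^sub>C bracket X Z" "bracket Z (c *\<^sub>C X) = c *\<^sub>C bracket Z X"
    "bracket (- X) Z = - bracket X Z" "bracket Z (- X) = - bracket Z X"
    "bracket 0 Z = 0" "bracket Z 0 = 0" "bracket X X = 0"
  by (simp_all add: bracket_def matrix_mult_linear cscale_mult_left cscale_mult_right
      cmat.scale_right_diff_distrib)

lemma bracket_skew: "bracket X Y = - bracket Y X"
  by (simp add: bracket_def)

section \<open>The frame of a group of type B\<close>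

context
  fixes D :: "'n::finite frame" and r :: nat
  assumes type_B: "simply_connected_type_B r D"
begin

lemma groups:
  "algebraic_group (grp D)" "algebraic_group (borel D)" "algebraic_group (borel_op D)"
  "algebraic_group (unip D)" "algebraic_group (unip_op D)" "algebraic_group (cartan D)"
  "borel D \<subseteq> grp D" "borel_op D \<subseteq> grp D" "unip D \<lhd> matgrp (borel D)"
  "unip_op D \<lhd> matgrp (borel_op D)" "torus (cartan D)"
  "\<And>A. A \<in> unip D \<Longrightarrow> \<exists>k. mpow (A - mat 1) k = 0"
  "\<And>A. A \<in> unip_op D \<Longrightarrow> \<exists>k. mpow (A - mat 1) k = 0"
  using type_B
  by (auto simp: simply_connected_type_B_def simple_algebraic_group_def opposite_borels_def
      borel_subgroup_def connected_solvable_subgroup_def maximal_torus_def torus_def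
      is_unipotent_radical_def connected_normal_unipotent_def cartan_def)

lemma unip_subset: "unip D \<subseteq> borel D" "unip_op D \<subseteq> borel_op D"
  using groups(9,10)[THEN normal_imp_subgroup, THEN subgroup.subset] by simp_all

lemma chevalley:
  shows "i \<in> {1..r} \<Longrightarrow> ee D i \<in> Lie (unip D)" "i \<in> {1..r} \<Longrightarrow> ff D i \<in> Lie (unip_op D)"
    and "cmat.independent (hh D ` {1..r})" "cmat.span (hh D ` {1..r}) = Lie (cartan D)"
    and "i \<in> {1..r} \<Longrightarrow> j \<in> {1..r} \<Longrightarrow> bracket (ee D i) (ff D j) = (if i = j then hh D i else 0)"
    and "i \<in> {1..r} \<Longrightarrow> bracket (hh D i) (ee D i) = 2 *\<^sub>C ee D i"
    and "i \<in> {1..r} \<Longrightarrow> bracket (hh D i) (ff D i) = - 2 *\<^sub>C ff D i"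
    and "i \<in> {1..r} \<Longrightarrow> hh D i \<in> Lie (cartan D)"
  using type_B cmat.span_base [of "hh D i" "hh D ` {1..r}"]
  by (auto simp: simply_connected_type_B_def chevalley_generators_def cartan_matrix_B_def)

lemma Lie_cartan_subspace: "cmat.subspace (Lie (cartan D))"
  unfolding chevalley(4) [symmetric] by (rule cmat.subspace_span)

text \<open>The value \<open>c = \<alpha>\<^sub>i(h)\<close>, extended linearly from the simple coroots.\<close>

lemma root_value_exists:
  assumes "h \<in> Lie (cartan D)" "i \<in> {1..r}"
  shows "\<exists>c. bracket h (ee D i) = c *\<^sub>C ee D i \<and> bracket h (ff D i) = - c *\<^sub>C ff D i"
proof -
  let ?P = "\<lambda>h. \<exists>c. bracket h (ee D i) = c *\<^sub>C ee D i \<and> bracket h (ff D i) = - c *\<^sub>C ff D i"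
  have "h \<in> cmat.span (hh D ` {1..r})"
    using assms chevalley(4) by simp
  then show ?thesis
  proof (induction rule: cmat.span_induct)
    case (step h)
    then obtain j where "j \<in> {1..r}" "h = hh D j" by auto
    then show ?case
      using type_B assms(2)
      by (auto simp: simply_connected_type_B_def chevalley_generators_def)
  next
    case base
    show ?case
    proof (rule cmat.subspaceI)
      show "0 \<in> Collect ?P"
        by (auto simp: bracket_linear intro: exI [of _ 0])
    next
      fix x y assume "x \<in> Collect ?P" "y \<in> Collect ?P"
      then obtain c d where "bracket x (ee D i) = c *\<^sub>C ee D i" "bracket x (ff D i) = - c *\<^sub>C ff D i"
          "bracket y (ee D i) = d *\<^sub>C ee D i" "bracket y (ff D i) = - d *\<^sub>C ff D i"
        by blast
      then show "x + y \<in> Collect ?P"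
        by (auto simp: bracket_linear cmat.scale_left_distrib cmat.scale_left_diff_distrib
            intro!: exI [of _ "c + d"])
    next
      fix a x assume "x \<in> Collect ?P"
      then obtain c where "bracket x (ee D i) = c *\<^sub>C ee D i" "bracket x (ff D i) = - c *\<^sub>C ff D i"
        by blast
      then show "a *\<^sub>C x \<in> Collect ?P"
        by (auto simp: bracket_linear intro!: exI [of _ "a * c"])
    qed
  qed
qed

section \<open>The Weyl group acting on the Cartan subalgebra\<close>

definition sbar_inv :: "nat \<Rightarrow> complex^'n^'n"
  where "sbar_inv i = mexp (ee D i) ** mexp (- ff D i) ** mexp (ee D i)"

lemma sbar_eq: "sbar D i = mexp (- ee D i) ** mexp (ff D i) ** mexp (- ee D i)"
  by (simp add: sbar_def xx_def yy_def)

lemma sbar_inverse: "sbar D i ** sbar_inv i = mat 1"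
proof -
  have "sbar D i ** sbar_inv i = mexp (- ee D i) ** (mexp (ff D i) ** ((mexp (- ee D i)
          ** mexp (ee D i)) ** mexp (- ff D i))) ** mexp (ee D i)"
    by (simp add: sbar_eq sbar_inv_def matrix_mul_assoc)
  then show ?thesis by (simp add: mexp_minus)
qed

text \<open>Three applications of \<open>Ad_mexp\<close> inside the \<open>sl\<^sub>2\<close>-triple \<open>(e\<^sub>i, h\<^sub>i, f\<^sub>i)\<close> give the reflection
  \<open>h \<mapsto> h - \<alpha>\<^sub>i(h) h\<^sub>i\<close>.\<close>

lemma sbar_conj:
  assumes i: "i \<in> {1..r}" and h: "h \<in> Lie (cartan D)"
  shows "matrix_inv (sbar D i) ** h ** sbar D i \<in> Lie (cartan D)"
proof -
  let ?e = "ee D i" and ?f = "ff D i" and ?h = "hh D i"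
  obtain c where c: "bracket h ?e = c *\<^sub>C ?e" "bracket h ?f = - c *\<^sub>C ?f"
    using root_value_exists [OF h i] by blast
  have br: "bracket ?e h = - c *\<^sub>C ?e" "bracket (- ?f) h = - c *\<^sub>C ?f"
      "bracket ?e ?h = - 2 *\<^sub>C ?e" "bracket (- ?f) ?h = - 2 *\<^sub>C ?f" "bracket (- ?f) ?e = ?h"
    using c chevalley(5) [OF i i] chevalley(6,7) [OF i]
    by (simp_all add: bracket_linear bracket_skew [of ?e h] bracket_skew [of ?f h]
        bracket_skew [of ?e ?h] bracket_skew [of ?f ?h] bracket_skew [of ?f ?e])
  let ?Ad = "\<lambda>X Y. mexp X ** Y ** mexp (- X)"
  have Ad: "?Ad ?e h = h - c *\<^sub>C ?e" "?Ad ?e ?e = ?e" "?Ad ?e ?h = ?h - 2 *\<^sub>C ?e"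
      "?Ad (- ?f) h = h - c *\<^sub>C ?f" "?Ad (- ?f) ?e = ?e + ?h - ?f"
    using Ad_mexp [OF br(1), of 0] Ad_mexp [of ?e ?e 0 0] Ad_mexp [OF br(3), of 0]
      Ad_mexp [OF br(2), of 0] Ad_mexp [OF br(5) br(4)]
    by (simp_all add: bracket_linear)
  have "matrix_inv (sbar D i) ** h ** sbar D i = sbar_inv i ** h ** sbar D i"
    by (simp add: matrix_inv_eqI [OF sbar_inverse])
  also have "\<dots> = ?Ad ?e (?Ad (- ?f) (?Ad ?e h))"
    by (simp add: sbar_eq sbar_inv_def matrix_mul_assoc)
  also have "\<dots> = h - c *\<^sub>C ?h"
  proof -
    have lin: "?Ad X (d *\<^sub>C Z) = d *\<^sub>C ?Ad X Z"
      "?Ad X (Y - Z) = ?Ad X Y - ?Ad X Z" "?Ad X (Y + Z) = ?Ad X Y + ?Ad X Z"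
      for X Y Z :: "complex^'n^'n" and d
      by (simp_all add: matrix_mult_linear cscale_mult_left cscale_mult_right)
    have 1: "?Ad (- ?f) (?Ad ?e h) = h - c *\<^sub>C (?e + ?h)"
      unfolding Ad(1) lin Ad(4,5) by (simp add: vec_eq_iff cscale_entry algebra_simps)
    show ?thesis
      unfolding 1 lin Ad by (simp add: vec_eq_iff cscale_entry algebra_simps)
  qed
  also have "\<dots> \<in> Lie (cartan D)"
    using h chevalley(8) [OF i] Lie_cartan_subspace
    by (intro cmat.subspace_diff cmat.subspace_scale)
  finally show ?thesis .
qed

definition sbar_prod :: "nat list \<Rightarrow> complex^'n^'n"
  where "sbar_prod js = foldr (\<lambda>j A. sbar D j ** A) js (mat 1)"

lemma sbar_prod_simps:
  "sbar_prod [] = mat 1" "sbar_prod (j # js) = sbar D j ** sbar_prod js"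
  by (simp_all add: sbar_prod_def)

lemma sbar_prod_inverse: "sbar_prod js ** matrix_inv (sbar_prod js) = mat 1"
proof -
  have "\<exists>B. sbar_prod js ** B = mat 1"
  proof (induction js)
    case Nil
    then show ?case by (auto simp: sbar_prod_simps)
  next
    case (Cons j js)
    then obtain B where B: "sbar_prod js ** B = mat 1" by blast
    have "sbar_prod (j # js) ** (B ** sbar_inv j) = sbar D j ** (sbar_prod js ** B) ** sbar_inv j"
      by (simp add: sbar_prod_simps matrix_mul_assoc)
    then show ?case using B sbar_inverse by auto
  qed
  then show ?thesis using matrix_inv_eqI by blast
qed

lemma cartan_fixes_Lie:
  assumes "b \<in> cartan D" "h \<in> Lie (cartan D)"
  shows "matrix_inv b ** h ** b = h"
proof -
  have "matrix_inv b ** h ** b = matrix_inv b ** (b ** h)"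
    using torus_fixes_Lie [OF groups(11) assms] by (simp add: matrix_mul_assoc)
  then show ?thesis
    using matgrp_inverse(4) [OF algebraic_group_group [OF groups(6)] assms(1)]
    by (simp add: matrix_mul_assoc)
qed

text \<open>A member of the coset of a word has the form \<open>b\<^sub>1 s\<^sub>1 b\<^sub>2 s\<^sub>2 \<cdots>\<close> with \<open>b\<^sub>j \<in> H\<close>. Conjugation by the
  \<open>b\<^sub>j\<close> is trivial on \<open>Lie H\<close>, so all members act on it as the product of the \<open>s\<^sub>j\<close> does.\<close>

lemma weyl_word_conj:
  assumes "set js \<subseteq> {1..r}" "n \<in> weyl_word D js" "h \<in> Lie (cartan D)"
  shows "n ** matrix_inv n = mat 1"
    and "matrix_inv n ** h ** n = matrix_inv (sbar_prod js) ** h ** sbar_prod js"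
    and "matrix_inv n ** h ** n \<in> Lie (cartan D)"
proof -
  have "n ** matrix_inv n = mat 1 \<and>
        matrix_inv n ** h ** n = matrix_inv (sbar_prod js) ** h ** sbar_prod js \<and>
        matrix_inv n ** h ** n \<in> Lie (cartan D)"
    using assms
  proof (induction js arbitrary: n h)
    case Nil
    then have "n \<in> cartan D"
      by (simp add: weyl_word_def weyl_group_def FactGroup_def)
    then show ?case
      using Nil cartan_fixes_Lie matgrp_inverse(3) [OF algebraic_group_group [OF groups(6)]]
      by (simp add: sbar_prod_simps matrix_inv_eqI)
  next
    case (Cons j js)
    from Cons.prems(2) obtain b n' where b: "b \<in> cartan D" and n': "n' \<in> weyl_word D js"
      and n: "n = b ** sbar D j ** n'"
      by (auto simp: weyl_word_def weyl_group_def FactGroup_def simple_reflection_def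
          set_mult_def r_coset_def)
    let ?h = "matrix_inv (sbar D j) ** h ** sbar D j"
    have h: "?h \<in> Lie (cartan D)"
      using Cons.prems by (intro sbar_conj) auto
    have IH: "n' ** matrix_inv n' = mat 1"
      "matrix_inv n' ** ?h ** n' = matrix_inv (sbar_prod js) ** ?h ** sbar_prod js"
      "matrix_inv n' ** ?h ** n' \<in> Lie (cartan D)"
      using Cons.IH [OF _ n' h] Cons.prems(1) by (meson order_trans set_subset_Cons)+
    have s: "sbar D j ** matrix_inv (sbar D j) = mat 1"
      using sbar_inverse [of j] matrix_inv_eqI by metis
    have bi: "b ** matrix_inv b = mat 1"
      using b matgrp_inverse(3) [OF algebraic_group_group [OF groups(6)]] by blast
    have bs: "(b ** sbar D j) ** matrix_inv (b ** sbar D j) = mat 1"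
      "matrix_inv (b ** sbar D j) = matrix_inv (sbar D j) ** matrix_inv b"
      using matrix_inv_mult [OF bi s] bi s matrix_mul_assoc
      by (metis matrix_mul_rid)+
    have ninv: "matrix_inv n = matrix_inv n' ** (matrix_inv (sbar D j) ** matrix_inv b)"
      unfolding n using matrix_inv_mult [OF bs(1) IH(1)] bs(2) by simp
    have "n ** matrix_inv n = (b ** sbar D j) ** (n' ** matrix_inv n') ** matrix_inv (b ** sbar D j)"
      unfolding ninv bs(2) by (simp add: n matrix_mul_assoc)
    then have 1: "n ** matrix_inv n = mat 1"
      using IH(1) bs(1) by simp
    have "matrix_inv n ** h ** n
        = matrix_inv n' ** (matrix_inv (sbar D j) ** (matrix_inv b ** h ** b) ** sbar D j) ** n'"
      unfolding ninv by (simp add: n matrix_mul_assoc)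
    then have 2: "matrix_inv n ** h ** n = matrix_inv n' ** ?h ** n'"
      using cartan_fixes_Lie [OF b Cons.prems(3)] by simp
    have 3: "matrix_inv (sbar_prod (j # js)) ** h ** sbar_prod (j # js)
        = matrix_inv (sbar_prod js) ** ?h ** sbar_prod js"
      unfolding sbar_prod_simps matrix_inv_mult [OF s sbar_prod_inverse]
      by (simp add: matrix_mul_assoc)
    from 1 2 3 IH show ?case by metis
  qed
  then show "n ** matrix_inv n = mat 1"
    "matrix_inv n ** h ** n = matrix_inv (sbar_prod js) ** h ** sbar_prod js"
    "matrix_inv n ** h ** n \<in> Lie (cartan D)"
    by auto
qed

lemma weyl_word_nonempty: "\<exists>n. n \<in> weyl_word D js"
proof (induction js)
  case Nil
  then show ?case
    using algebraic_group_one [OF groups(6)]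
    by (auto simp: weyl_word_def weyl_group_def FactGroup_def)
next
  case (Cons j js)
  then show ?case
    using algebraic_group_one [OF groups(6)]
    by (auto simp: weyl_word_def weyl_group_def FactGroup_def simple_reflection_def
        set_mult_def r_coset_def)
qed

lemma wbar_eq_sbar_prod:
  assumes "set js \<subseteq> {1..r}"
  obtains js' where "set js' \<subseteq> {1..r}" "weyl_word D js' = weyl_word D js"
    "wbar r D (weyl_word D js) = sbar_prod js'"
proof -
  let ?w = "weyl_word D js"
  have "\<exists>js'. reduced_word r D ?w js'"
    using ex_has_least_nat [of "\<lambda>js'. set js' \<subseteq> {1..r} \<and> weyl_word D js' = ?w" js length] assms
    unfolding reduced_word_def by blast
  then have "reduced_word r D ?w (SOME js'. reduced_word r D ?w js')"
    by (rule someI_ex)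
  then show thesis
    by (intro that) (auto simp: reduced_word_def wbar_def sbar_prod_def)
qed

text \<open>The representative chosen in \<open>weyl_act\<close> and the one given by a reduced word belong to the same
  coset.\<close>

lemma weyl_act_eq:
  assumes "set js \<subseteq> {1..r}" "h \<in> Lie (cartan D)"
  shows "weyl_act (weyl_word D js) \<mu> h
    = \<mu> (matrix_inv (wbar r D (weyl_word D js)) ** h ** wbar r D (weyl_word D js))"
proof -
  obtain js' where js': "set js' \<subseteq> {1..r}" "weyl_word D js' = weyl_word D js"
    "wbar r D (weyl_word D js) = sbar_prod js'"
    using wbar_eq_sbar_prod [OF assms(1)] .
  have "(SOME n. n \<in> weyl_word D js) \<in> weyl_word D js'"
    unfolding js'(2) using weyl_word_nonempty by (rule someI_ex)
  then show ?thesis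
    unfolding weyl_act_def Let_def js'(3)
    using weyl_word_conj(2) [OF js'(1) _ assms(2)] by simp
qed

section \<open>Torus parts\<close>

text \<open>If \<open>n' a n = m' b m\<close>, then \<open>m'\<^sup>-\<^sup>1 n' = b m (a n)\<^sup>-\<^sup>1\<close> lies in \<open>N\<^sub>-\<close> and in \<open>B \<inter> B\<^sub>- = H\<close>, so it is \<open>1\<close>;
  then \<open>m n\<^sup>-\<^sup>1 = b\<^sup>-\<^sup>1 a\<close> lies in \<open>N \<inter> H\<close>, so it is \<open>1\<close> too.\<close>

lemma torus_part_eq:
  assumes n': "n' \<in> unip_op D" and a: "a \<in> cartan D" and n: "n \<in> unip D"
  shows "torus_part D (n' ** a ** n) = a"
  unfolding torus_part_def
proof (rule the_equality)
  show "a \<in> cartan D \<and> (\<exists>m'\<in>unip_op D. \<exists>m\<in>unip D. n' ** a ** n = m' ** a ** m)"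
    using assms by blast
next
  fix b
  assume "b \<in> cartan D \<and> (\<exists>m'\<in>unip_op D. \<exists>m\<in>unip D. n' ** a ** n = m' ** b ** m)"
  then obtain m' m where b: "b \<in> cartan D" and m': "m' \<in> unip_op D" and m: "m \<in> unip D"
    and eq: "n' ** a ** n = m' ** b ** m"
    by blast
  note inv = matgrp_inverse [OF algebraic_group_group]
  note mem = assms b m' m
  have one: "A = mat 1" if "A \<in> cartan D" "A \<in> unip D \<or> A \<in> unip_op D" for A
    using that groups(12,13) torus_unipotent_eq_one [OF groups(11) that(1)] by blast
  have borel: "a \<in> borel D" "b \<in> borel D" "m \<in> borel D" "n \<in> borel D"
    using mem unip_subset by (auto simp: cartan_def)
  let ?v = "matrix_inv m' ** n'"
  have "?v ** (a ** n) = matrix_inv m' ** (m' ** b ** m)"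
    unfolding eq [symmetric] by (simp add: matrix_mul_assoc)
  also have "\<dots> = (matrix_inv m' ** m') ** b ** m"
    by (simp add: matrix_mul_assoc)
  finally have v: "?v ** (a ** n) = b ** m"
    using inv(4) [OF groups(5) m'] by simp
  have an: "a ** n \<in> borel D"
    using borel by (intro algebraic_group_mult [OF groups(2)])
  have "?v = ?v ** (a ** n ** matrix_inv (a ** n))"
    using inv(3) [OF groups(2) an] by simp
  then have "?v = b ** m ** matrix_inv (a ** n)"
    using v by (simp add: matrix_mul_assoc)
  then have "?v \<in> borel D"
    using borel an inv(2) [OF groups(2)] by (auto intro!: algebraic_group_mult [OF groups(2)])
  moreover have v_unip: "?v \<in> unip_op D"
    using mem inv(2) [OF groups(5)] by (auto intro!: algebraic_group_mult [OF groups(5)])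
  ultimately have "?v = mat 1"
    using unip_subset one [of ?v] by (auto simp: cartan_def)
  with v have an_bm: "a ** n = b ** m"
    by simp
  let ?u = "m ** matrix_inv n"
  have "b ** ?u = a ** n ** matrix_inv n"
    by (simp add: an_bm matrix_mul_assoc)
  then have bu: "b ** ?u = a"
    using inv(3) [OF groups(4) n] by (simp flip: matrix_mul_assoc)
  then have "?u = matrix_inv b ** a"
    using inv(4) [OF groups(6) b] by (metis matrix_mul_assoc matrix_mul_lid)
  then have "?u \<in> cartan D"
    using a b inv(2) [OF groups(6)] by (auto intro!: algebraic_group_mult [OF groups(6)])
  moreover have "?u \<in> unip D"
    using mem inv(2) [OF groups(4)] by (auto intro!: algebraic_group_mult [OF groups(4)])
  ultimately have "?u = mat 1"
    using one by blast
  with bu show "b = a" by simp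
qed

section \<open>Products of exponentials of Chevalley generators\<close>

text \<open>All multiples of the simple root vectors, so that the set is stable under scaling as the whole
  one-parameter subgroups are needed.\<close>

definition root_vectors :: "(nat \<Rightarrow> complex^'n^'n) \<Rightarrow> (complex^'n^'n) set"
  where "root_vectors g = {c *\<^sub>C g i | c i. i \<in> {1..r}}"

lemma root_vectors_scale:
  assumes "X \<in> root_vectors g"
  shows "c *\<^sub>C X \<in> root_vectors g"
proof -
  obtain d i where "i \<in> {1..r}" "X = d *\<^sub>C g i"
    using assms by (auto simp: root_vectors_def)
  then have "c *\<^sub>C X = (c * d) *\<^sub>C g i \<and> i \<in> {1..r}"
    by simp
  then show ?thesis
    unfolding root_vectors_def by blast
qed

definition generators :: "(complex^'n^'n) set"
  where "generators = root_vectors (ff D) \<union> Lie (cartan D) \<union> root_vectors (ee D)"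

lemma root_vectors_Lie: "root_vectors (ff D) \<subseteq> Lie (unip_op D)" "root_vectors (ee D) \<subseteq> Lie (unip D)"
  using chevalley(1,2) by (auto simp: root_vectors_def intro: Lie_scale)

lemma generators_Lie: "generators \<subseteq> Lie (grp D)"
proof -
  have "unip D \<subseteq> grp D" "unip_op D \<subseteq> grp D" "cartan D \<subseteq> grp D"
    using unip_subset groups(7,8) by (auto simp: cartan_def)
  then show ?thesis
    using root_vectors_Lie unfolding generators_def by (meson Lie_mono Un_least order_trans)
qed

lemma generator_memI:
  "i \<in> {1..r} \<Longrightarrow> c *\<^sub>C ee D i \<in> generators" "i \<in> {1..r} \<Longrightarrow> c *\<^sub>C ff D i \<in> generators"
  "h \<in> Lie (cartan D) \<Longrightarrow> h \<in> generators"
  by (auto simp: generators_def root_vectors_def)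

lemma generators_bracket:
  "X \<in> Lie (cartan D) \<Longrightarrow> Y \<in> root_vectors (ff D) \<Longrightarrow> bracket X Y \<in> generators"
  "X \<in> root_vectors (ee D) \<Longrightarrow> Y \<in> root_vectors (ff D) \<Longrightarrow> bracket X Y \<in> generators"
  "X \<in> root_vectors (ee D) \<Longrightarrow> Y \<in> Lie (cartan D) \<Longrightarrow> bracket X Y \<in> generators"
proof -
  assume "X \<in> Lie (cartan D)" "Y \<in> root_vectors (ff D)"
  then obtain c i where i: "i \<in> {1..r}" "Y = c *\<^sub>C ff D i"
    by (auto simp: root_vectors_def)
  obtain d where "bracket X (ff D i) = - d *\<^sub>C ff D i"
    using root_value_exists [OF \<open>X \<in> Lie (cartan D)\<close>, of i] i by blast
  then have "bracket X Y = (- c * d) *\<^sub>C ff D i"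
    using i by (simp add: bracket_linear)
  then show "bracket X Y \<in> generators"
    using generator_memI i(1) by metis
next
  assume "X \<in> root_vectors (ee D)" "Y \<in> root_vectors (ff D)"
  then obtain c i d j where "i \<in> {1..r}" "j \<in> {1..r}" "X = c *\<^sub>C ee D i" "Y = d *\<^sub>C ff D j"
    by (auto simp: root_vectors_def)
  then have "bracket X Y = (if i = j then (c * d) *\<^sub>C hh D i else 0)"
    using chevalley(5) by (auto simp: bracket_linear)
  also have "\<dots> \<in> Lie (cartan D)"
    using chevalley(8) \<open>i \<in> {1..r}\<close> cmat.subspace_0 [OF Lie_cartan_subspace]
    by (auto intro: Lie_scale)
  finally show "bracket X Y \<in> generators"
    by (rule generator_memI)
next
  assume "X \<in> root_vectors (ee D)" "Y \<in> Lie (cartan D)"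
  then obtain c i where i: "i \<in> {1..r}" "X = c *\<^sub>C ee D i"
    by (auto simp: root_vectors_def)
  obtain d where d: "bracket Y (ee D i) = d *\<^sub>C ee D i"
    using root_value_exists [OF \<open>Y \<in> Lie (cartan D)\<close>, of i] i by blast
  have "bracket X Y = (- c * d) *\<^sub>C ee D i"
    using i d by (simp add: bracket_linear bracket_skew [of "ee D i"])
  then show "bracket X Y \<in> generators"
    using generator_memI i(1) by metis
qed

text \<open>Closed under products and inverses; this subgroup contains both the representatives \<open>W\<close> and the
  points \<open>x\<^sup>L(Y)\<close>.\<close>

definition gen_products :: "(complex^'n^'n) set"
  where "gen_products = mexp_prod ` lists generators"

lemma gen_products_one: "mat 1 \<in> gen_products"
  unfolding gen_products_def using mexp_prod_simps(1) by (metis imageI lists.Nil)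

lemma gen_products_mexp:
  assumes "X \<in> generators"
  shows "mexp X \<in> gen_products"
proof -
  have "[X] \<in> lists generators" using assms by simp
  then have "mexp_prod [X] \<in> gen_products"
    unfolding gen_products_def by (rule imageI)
  then show ?thesis by simp
qed

lemma gen_products_mult: "A \<in> gen_products \<Longrightarrow> B \<in> gen_products \<Longrightarrow> A ** B \<in> gen_products"
  unfolding gen_products_def
  by (auto simp flip: mexp_prod_append simp del: in_lists_conv_set intro!: imageI)

lemma gen_products_inverse:
  assumes "A \<in> gen_products"
  shows "\<exists>B\<in>gen_products. A ** B = mat 1"
proof -
  obtain Xs where "A = mexp_prod Xs" "Xs \<in> lists generators"
    using assms by (auto simp: gen_products_def)
  from this(2) have "\<exists>B\<in>gen_products. mexp_prod Xs ** B = mat 1"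
  proof induction
    case Nil
    show ?case using gen_products_one by auto
  next
    case (Cons X Xs)
    then obtain B where B: "B \<in> gen_products" "mexp_prod Xs ** B = mat 1" by blast
    have "- X \<in> generators"
    proof -
      have "(- 1) *\<^sub>C X \<in> generators"
        using Cons.hyps(1) Lie_scale root_vectors_scale unfolding generators_def by blast
      then show ?thesis by simp
    qed
    then have "B ** mexp (- X) \<in> gen_products"
      using B by (intro gen_products_mult gen_products_mexp)
    moreover have "mexp_prod (X # Xs) ** (B ** mexp (- X)) = mat 1"
    proof -
      have "mexp_prod (X # Xs) ** (B ** mexp (- X)) = mexp X ** (mexp_prod Xs ** B) ** mexp (- X)"
        by (simp add: matrix_mul_assoc)
      then show ?thesis by (simp add: B mexp_minus)
    qed
    ultimately show ?case by blast
  qed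
  with \<open>A = mexp_prod Xs\<close> show ?thesis by simp
qed

lemma gen_products_in_group: "gen_products \<subseteq> grp D"
  unfolding gen_products_def
  using mexp_prod_in_group [OF groups(1)] lists_mono [OF generators_Lie] by blast

lemma sbar_prod_gen_products:
  assumes "set js \<subseteq> {1..r}"
  shows "sbar_prod js \<in> gen_products"
  using assms
proof (induction js)
  case Nil
  then show ?case by (simp add: sbar_prod_simps gen_products_one)
next
  case (Cons j js)
  then show ?case
    unfolding sbar_prod_simps sbar_def xx_def yy_def
    by (intro gen_products_mult gen_products_mexp generator_memI) auto
qed

lemma xL_gen_products:
  assumes "set js \<subseteq> {1..r}"
  shows "xL D js ts \<in> gen_products"
proof -
  have "foldr (\<lambda>(i, t) A. xneg D i t ** A) ps (mat 1) \<in> gen_products"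
    if "fst ` set ps \<subseteq> {1..r}" for ps
    using that
  proof (induction ps)
    case (Cons it ps)
    obtain i t where it: "it = (i, t)" by (cases it)
    have "xneg D i t \<in> gen_products"
      unfolding xneg_def yy_def coroot_def torus_power_def
      using Cons.prems chevalley(8) [of i]
      by (intro gen_products_mult gen_products_mexp generator_memI) (auto simp: it intro: Lie_scale)
    then show ?case
      using Cons by (auto simp: it intro: gen_products_mult)
  qed (simp add: gen_products_one)
  moreover have "fst ` set (zip js ts) \<subseteq> {1..r}"
    using assms set_zip_leftD by fastforce
  ultimately show ?thesis
    unfolding xL_def by blast
qed

section \<open>Torus equivariance of generalized minors\<close>

text \<open>The identity is checked on the translated big cell, rewritten as the vanishing of a polynomial
  function \<open>q\<close>, and continued to all products of exponentials.\<close>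

lemma minor_torus_equivariant:
  assumes js: "set js \<subseteq> {1..r}"
    and f: "is_generalized_minor r D (weyl_word D js) i f"
    and h: "h \<in> Lie (cartan D)"
    and x: "x \<in> gen_products"
  shows "f (mexp (l *\<^sub>C h) ** x)
    = exp (l * weyl_act (weyl_word D js) (fundamental_weight r D i) h) * f x"
proof -
  let ?\<mu> = "fundamental_weight r D i"
  define W where "W = wbar r D (weyl_word D js)"
  obtain js' where js': "set js' \<subseteq> {1..r}" "weyl_word D js' = weyl_word D js" "W = sbar_prod js'"
    unfolding W_def using wbar_eq_sbar_prod [OF js] .
  have W_gen: "W \<in> gen_products"
    unfolding js'(3) by (rule sbar_prod_gen_products) (rule js')
  have WW: "W ** matrix_inv W = mat 1"
    unfolding js'(3) by (rule sbar_prod_inverse)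
  then have WW': "matrix_inv W ** W = mat 1"
    by (rule matrix_left_right_inverse1)
  define h' where "h' = matrix_inv W ** h ** W"
  have h': "h' \<in> Lie (cartan D)"
  proof -
    obtain n where "n \<in> weyl_word D js'"
      using weyl_word_nonempty by blast
    then show ?thesis
      using weyl_word_conj(2,3) [OF js'(1) _ h] by (auto simp: h'_def js'(3))
  qed
  define a where "a = mexp (l *\<^sub>C h)"
  define a' where "a' = mexp (l *\<^sub>C h')"
  have a'_cartan: "a' \<in> cartan D"
    unfolding a'_def by (intro mexp_in_group Lie_scale h')
  have aW: "a ** W = W ** a'"
  proof -
    have "matrix_inv W ** a ** W = a'"
      unfolding a_def a'_def h'_def mexp_conj [OF WW]
      by (simp add: cscale_mult_left cscale_mult_right)
    then have "W ** a' = W ** (matrix_inv W ** a ** W)"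
      by (simp only:)
    also have "\<dots> = (W ** matrix_inv W) ** a ** W"
      by (simp only: matrix_mul_assoc)
    finally have "W ** a' = (W ** matrix_inv W) ** a ** W" .
    then show ?thesis by (simp add: WW)
  qed
  define c where "c = exp (l * ?\<mu> h')"
  obtain \<psi> where \<psi>: "weight_character (cartan D) ?\<mu> \<psi>"
    and f_cell: "\<And>y. y \<in> big_cell D \<Longrightarrow> f (W ** y) = \<psi> (torus_part D (matrix_inv W ** (W ** y)))"
    using f unfolding is_generalized_minor_def W_def by blast
  have \<psi>_a': "\<psi> a' = c"
  proof -
    have "?\<mu> (l *\<^sub>C h') = l * ?\<mu> h'"
      unfolding fundamental_weight_def
      using h' chevalley(3,4) by (simp add: cmat.representation_scale)
    then show ?thesis
      using \<psi> Lie_scale [OF h', of l] by (simp add: weight_character_def a'_def c_def)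
  qed
  have cell: "f (a ** (W ** (n' ** b ** n))) = c * f (W ** (n' ** b ** n))"
    if n': "n' \<in> unip_op D" and b: "b \<in> cartan D" and n: "n \<in> unip D" for n' b n
  proof -
    let ?n' = "a' ** n' ** matrix_inv a'"
    have val: "f (W ** (n' ** b ** n)) = \<psi> b"
      if "n' \<in> unip_op D" "b \<in> cartan D" for n' b
    proof -
      have "n' ** b ** n \<in> big_cell D"
        using that n by (auto simp: big_cell_def)
      moreover have "matrix_inv W ** (W ** y) = y" for y :: "complex^'n^'n"
        using WW' by (simp add: matrix_mul_assoc)
      ultimately show ?thesis
        using f_cell torus_part_eq [OF that n] by simp
    qed
    have "?n' \<in> unip_op D"
      using normal_matgrp_conj [OF groups(10) _ n'] a'_cartan by (simp add: cartan_def)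
    moreover have a'b: "a' ** b \<in> cartan D"
      using a'_cartan b by (rule algebraic_group_mult [OF groups(6)])
    ultimately have "f (W ** (?n' ** (a' ** b) ** n)) = \<psi> (a' ** b)"
      by (rule val)
    moreover have "W ** (?n' ** (a' ** b) ** n) = a ** (W ** (n' ** b ** n))"
    proof -
      have "?n' ** (a' ** b) ** n = a' ** n' ** (matrix_inv a' ** a') ** b ** n"
        by (simp add: matrix_mul_assoc)
      then have "?n' ** (a' ** b) ** n = a' ** (n' ** b ** n)"
        using matgrp_inverse(4) [OF algebraic_group_group [OF groups(6)] a'_cartan]
        by (simp add: matrix_mul_assoc)
      then have "W ** (?n' ** (a' ** b) ** n) = (W ** a') ** (n' ** b ** n)"
        by (simp add: matrix_mul_assoc)
      then show ?thesis
        by (simp add: matrix_mul_assoc flip: aW)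
    qed
    moreover have "\<psi> (a' ** b) = c * \<psi> b"
      using \<psi> a'_cartan b \<psi>_a' by (simp add: weight_character_def)
    ultimately show ?thesis
      using val [OF n' b] by simp
  qed
  obtain p K where p: "p \<in> polynomial_functions"
    and f_eq: "\<And>A. A \<in> grp D \<Longrightarrow> f A = p A / det A ^ K"
    using f unfolding is_generalized_minor_def regular_on_def by blast
  \<comment> \<open>Up to the factor \<open>det a ^ K * det A ^ K\<close>, this is \<open>f (a ** A) - c * f A\<close> on the group.\<close>
  define q where "q A = p (a ** A) + (- c * det a ^ K) * p A" for A
  have a_gen: "a \<in> gen_products"
    unfolding a_def by (intro gen_products_mexp generator_memI Lie_scale h)
  have q_iff: "q A = 0 \<longleftrightarrow> f (a ** A) = c * f A" if "A \<in> grp D" for A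
  proof -
    have "a \<in> grp D" using a_gen gen_products_in_group by blast
    then have "det a \<noteq> 0" "det A \<noteq> 0" "a ** A \<in> grp D"
      using that algebraic_group_invertible [OF groups(1)] algebraic_group_mult [OF groups(1)]
      by (auto simp: invertible_det_nz)
    then show ?thesis
      using that by (simp add: f_eq q_def det_mul power_mult_distrib field_simps)
  qed
  \<comment> \<open>Translating by \<open>W\<close> moves the translated cell to \<open>N\<^sub>- H N\<close> and the point \<open>x\<close> to \<open>V ** x\<close>.\<close>
  obtain V where V: "V \<in> gen_products" "W ** V = mat 1"
    using gen_products_inverse [OF W_gen] by blast
  obtain Ys where Ys: "Ys \<in> lists generators" "mexp_prod Ys = V ** x"
    using gen_products_mult [OF V(1) x] unfolding gen_products_def by (metis imageE)
  have "q (W ** mexp_prod Ys) = 0"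
  proof (rule polynomial_vanishing_from_triangular_products [where F = "root_vectors (ff D)" and
        T = "Lie (cartan D)" and E = "root_vectors (ee D)", folded generators_def])
    show "(\<lambda>A. q (W ** A)) \<in> polynomial_functions"
      unfolding q_def
      by (intro polynomial_functions.add polynomial_functions.mult polynomial_functions.const
          polynomial_functions_translate [where p = "\<lambda>A. p (a ** A) + (- c * det a ^ K) * p A"]
          polynomial_functions_translate [where p = p] p)
  next
    fix fs ts es
    assume lists: "fs \<in> lists (root_vectors (ff D))" "ts \<in> lists (Lie (cartan D))"
      "es \<in> lists (root_vectors (ee D))"
    let ?y = "mexp_prod fs ** mexp_prod ts ** mexp_prod es"
    have "mexp_prod fs \<in> unip_op D"
      using lists(1) lists_mono [OF root_vectors_Lie(1)]
      by (intro mexp_prod_in_group [OF groups(5)]) blast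
    moreover have "mexp_prod ts \<in> cartan D"
      using lists(2) by (intro mexp_prod_in_group [OF groups(6)])
    moreover have "mexp_prod es \<in> unip D"
      using lists(3) lists_mono [OF root_vectors_Lie(2)]
      by (intro mexp_prod_in_group [OF groups(4)]) blast
    ultimately have "f (a ** (W ** ?y)) = c * f (W ** ?y)" and "?y \<in> grp D"
      using cell unip_subset groups(7,8)
      by (auto simp: cartan_def intro!: algebraic_group_mult [OF groups(1)])
    moreover have "W \<in> grp D"
      using W_gen gen_products_in_group by blast
    ultimately show "q (W ** ?y) = 0"
      using q_iff algebraic_group_mult [OF groups(1)] by blast
  qed (use Ys(1) in \<open>simp_all add: generators_bracket Lie_scale root_vectors_scale del: in_lists_conv_set\<close>)
  then have "q x = 0"
    by (simp add: Ys V matrix_mul_assoc)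
  then have "f (a ** x) = c * f x"
    using q_iff x gen_products_in_group by blast
  then show ?thesis
    using weyl_act_eq [OF js h] by (simp add: a_def c_def h'_def W_def)
qed

end

theorem proposition5p3:
  fixes D :: "'n::finite frame"
    and r m p k d :: nat
    and js :: "nat list"
    and Y :: "nat \<Rightarrow> nat \<Rightarrow> complex"
    and \<Delta> :: "complex^'n^'n \<Rightarrow> complex"
    and t logt :: complex
    and h a :: "complex^'n^'n"
  assumes "simply_connected_type_B r D"
    and "1 \<le> m" and "m \<le> r" and "1 \<le> p" and "p \<le> r"
    and "js = cyclic_word r m p"
    and "\<And>s j. 1 \<le> s \<Longrightarrow> s \<le> m \<Longrightarrow> 1 \<le> j \<Longrightarrow> j \<le> (if s = m then p else r) \<Longrightarrow> Y s j \<noteq> 0"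
    and "1 \<le> k" and "k \<le> (m - 1) * r + p"
    and "d = letter js k"
    and "is_Delta r D js k \<Delta>"
    and "h \<in> Lie (cartan D)"
    and "t \<noteq> 0" and "exp logt = t"
    and "a = torus_power logt h"
  shows "Delta_G D js \<Delta> (a, variable_list r m p Y) =
           exp (logt * weyl_act (u_le D js k) (fundamental_weight r D d) h) *
           Delta_L D js \<Delta> (variable_list r m p Y)"
proof -
  have js: "set js \<subseteq> {1..r}"
    using assms(5,6) by (auto simp: cyclic_word_def set_replicate_conv_if split: if_splits)
  then have "set (take k js) \<subseteq> {1..r}"
    using set_take_subset by fastforce
  then show ?thesis
    using minor_torus_equivariant [OF assms(1), of "take k js" d \<Delta> h "xL D js (variable_list r m p Y)" logt]
      xL_gen_products [OF assms(1) js] assms(10,11,12,15)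
    by (simp add: Delta_G_def Delta_L_def xG_def torus_power_def is_Delta_def u_le_def)
qed

end
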